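(* Let $\mathbb I\subseteq\mathbb R$ be a compact interval, let $A$ and $B$ be non-empty sets, and let $\varphi\colon A\times B\to\mathbb I$ be a function. Then the following are equivalent: (1) The function $\varphi$ has the double limit property. (2) The function $\overline\varphi\colon\varphi_A\times\varphi^B\to\mathbb I$ extends to a separately continuous function $\overline{\varphi_A}\times\overline{\varphi^B}\to\mathbb I$. (3) The function $\overline\varphi\colon\varphi_A\times\varphi^B\to\mathbb I$ extends to a separately continuous, separately affine function $\overline{\mathrm{co}}(\varphi_A)\times\overline{\mathrm{co}}(\varphi^B)\to\mathbb I$. (4) Every $p\in\overline{\varphi_A}$ is $\varphi$-mean-definable, and every $q\in\overline{\varphi^B}$ is $\varphi^{\mathrm{op}}$-mean-definable. (5) Every $p\in\overline{\mathrm{co}}(\varphi_A)$ is $\varphi$-mean-definable, and every $q\in\overline{\mathrm{co}}(\varphi^B)$ is $\varphi^{\mathrm{op}}$-mean-definable. Moreover, the extensions in (2) and (3) are unique.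
   Context: For $a\in A$ define $\varphi_a\in\mathbb I^B$ by $\varphi_a(b)=\varphi(a,b)$, and for $b\in B$ define $\varphi^b\in\mathbb I^A$ by $\varphi^b(a)=\varphi(a,b)$. Put $\varphi_A=\{\varphi_a:a\in A\}\subseteq\mathbb I^B$ and $\varphi^B=\{\varphi^b:b\in B\}\subseteq\mathbb I^A$. The sets $\mathbb I^B\subseteq\mathbb R^B$ and $\mathbb I^A\subseteq\mathbb R^A$ carry the product topology (pointwise convergence); $\overline{X}$ denotes the closure of $X$, $\mathrm{co}(X)$ its convex hull and $\overline{\mathrm{co}}(X)$ its closed convex hull, in that topology. The function $\overline\varphi\colon\varphi_A\times\varphi^B\to\mathbb I$ is defined by $\overline\varphi(\varphi_a,\varphi^b)=\varphi(a,b)$ (this is well defined). Define $\varphi^{\mathrm{op}}\colon B\times A\to\mathbb I$ by $\varphi^{\mathrm{op}}(b,a)=\varphi(a,b)$. Double limit property: for any sequences $(a_n)$ in $A$ and $(b_m)$ in $B$, $\lim_n\lim_m\varphi(a_n,b_m)=\lim_m\lim_n\varphi(a_n,b_m)$ as soon as all the limits exist. Mean-definability: $p\in\mathbb I^B$ is $\varphi$-mean-definable if it belongs to the closure of $\mathrm{co}(\varphi_A)$ for uniform convergence on $B$; i.e. for every $\varepsilon>0$ there is a finite sequence $(a_i:i<n)$ in $A$ with $\sup_{b\in B}\left|p(b)-\frac1n\sum_{i<n}\varphi(a_i,b)\right|\le\varepsilon$. Similarly, $q\in\mathbb I^A$ is $\varphi^{\mathrm{op}}$-mean-definable if it belongs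 to the uniform closure (on $A$) of $\mathrm{co}(\varphi^B)$. *)

theory Defs
  imports "HOL-Analysis.Analysis" "HOL-Library.Function_Algebras"
begin

text \<open>The library supplies the pointwise addition on functions but no scalar multiplication.
  With it, \<open>convex hull\<close> and \<open>convex\<close> are available for sets of functions.\<close>

instantiation "fun" :: (type, real_vector) real_vector
begin

definition scaleR_fun :: "real \<Rightarrow> ('a \<Rightarrow> 'b) \<Rightarrow> 'a \<Rightarrow> 'b" where
  "scaleR_fun c f = (\<lambda>x. c *\<^sub>R f x)"

instance
  by standard (auto simp: scaleR_fun_def fun_eq_iff scaleR_add_right scaleR_add_left)

end

text \<open>
  The set \<open>\<real>\<^sup>B\<close> is represented by \<open>extensional B\<close>, the carrier of \<open>powertop_real B\<close>: outside \<open>B\<close> its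
  members take the fixed value \<open>undefined\<close>. Since \<open>(1 - t) * c + t * c = c\<close>, this set is closed under
  pointwise convex (indeed affine) combinations, so convex hulls, which are formed in the
  space of all functions, agree with those in \<open>\<real>\<^sup>B\<close>.

  \<open>sections A B \<phi>\<close> is \<open>\<phi>\<^sub>A \<subseteq> \<real>\<^sup>B\<close>, and \<open>sections B A (op_fun \<phi>)\<close> is \<open>\<phi>\<^sup>B \<subseteq> \<real>\<^sup>A\<close>.
\<close>

definition op_fun :: "('a \<Rightarrow> 'b \<Rightarrow> real) \<Rightarrow> 'b \<Rightarrow> 'a \<Rightarrow> real" where
  "op_fun \<phi> = (\<lambda>b a. \<phi> a b)"

definition section_at :: "'b set \<Rightarrow> ('a \<Rightarrow> 'b \<Rightarrow> real) \<Rightarrow> 'a \<Rightarrow> 'b \<Rightarrow> real" where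
  "section_at B \<phi> a = restrict (\<phi> a) B"

definition sections :: "'a set \<Rightarrow> 'b set \<Rightarrow> ('a \<Rightarrow> 'b \<Rightarrow> real) \<Rightarrow> ('b \<Rightarrow> real) set" where
  "sections A B \<phi> = section_at B \<phi> ` A"

definition cl_sections :: "'a set \<Rightarrow> 'b set \<Rightarrow> ('a \<Rightarrow> 'b \<Rightarrow> real) \<Rightarrow> ('b \<Rightarrow> real) set" where
  "cl_sections A B \<phi> = powertop_real B closure_of sections A B \<phi>"

definition cl_co_sections :: "'a set \<Rightarrow> 'b set \<Rightarrow> ('a \<Rightarrow> 'b \<Rightarrow> real) \<Rightarrow> ('b \<Rightarrow> real) set" where
  "cl_co_sections A B \<phi> = powertop_real B closure_of (convex hull sections A B \<phi>)"

definition double_limit_property :: "'a set \<Rightarrow> 'b set \<Rightarrow> ('a \<Rightarrow> 'b \<Rightarrow> real) \<Rightarrow> bool" where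
  "double_limit_property A B \<phi> \<longleftrightarrow>
    (\<forall>(a :: nat \<Rightarrow> 'a) (b :: nat \<Rightarrow> 'b).
       range a \<subseteq> A \<longrightarrow> range b \<subseteq> B \<longrightarrow>
       (\<forall>n. convergent (\<lambda>m. \<phi> (a n) (b m))) \<longrightarrow>
       convergent (\<lambda>n. lim (\<lambda>m. \<phi> (a n) (b m))) \<longrightarrow>
       (\<forall>m. convergent (\<lambda>n. \<phi> (a n) (b m))) \<longrightarrow>
       convergent (\<lambda>m. lim (\<lambda>n. \<phi> (a n) (b m))) \<longrightarrow>
       lim (\<lambda>n. lim (\<lambda>m. \<phi> (a n) (b m))) = lim (\<lambda>m. lim (\<lambda>n. \<phi> (a n) (b m))))"

definition mean_definable :: "'a set \<Rightarrow> 'b set \<Rightarrow> ('a \<Rightarrow> 'b \<Rightarrow> real) \<Rightarrow> ('b \<Rightarrow> real) \<Rightarrow> bool" where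
  "mean_definable A B \<phi> p \<longleftrightarrow>
    (\<forall>\<epsilon>>0. \<exists>(n :: nat) (a :: nat \<Rightarrow> 'a). n > 0 \<and> (\<forall>i<n. a i \<in> A) \<and>
       (\<forall>b\<in>B. \<bar>p b - (1 / real n) * (\<Sum>i<n. \<phi> (a i) b)\<bar> \<le> \<epsilon>))"

definition separately_continuous_on ::
  "'x topology \<Rightarrow> 'y topology \<Rightarrow> 'x set \<Rightarrow> 'y set \<Rightarrow> ('x \<Rightarrow> 'y \<Rightarrow> real) \<Rightarrow> bool" where
  "separately_continuous_on T U X Y F \<longleftrightarrow>
    (\<forall>x\<in>X. continuous_map (subtopology U Y) euclideanreal (\<lambda>y. F x y)) \<and>
    (\<forall>y\<in>Y. continuous_map (subtopology T X) euclideanreal (\<lambda>x. F x y))"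

definition affine_map_on :: "'x::real_vector set \<Rightarrow> ('x \<Rightarrow> real) \<Rightarrow> bool" where
  "affine_map_on X f \<longleftrightarrow>
    (\<forall>x\<in>X. \<forall>y\<in>X. \<forall>t\<in>{0..1}. f ((1 - t) *\<^sub>R x + t *\<^sub>R y) = (1 - t) * f x + t * f y)"

definition separately_affine_on ::
  "'x::real_vector set \<Rightarrow> 'y::real_vector set \<Rightarrow> ('x \<Rightarrow> 'y \<Rightarrow> real) \<Rightarrow> bool" where
  "separately_affine_on X Y F \<longleftrightarrow>
    (\<forall>x\<in>X. affine_map_on Y (\<lambda>y. F x y)) \<and> (\<forall>y\<in>Y. affine_map_on X (\<lambda>x. F x y))"

text \<open>\<open>F\<close> agrees with \<open>(\<phi>\<^sub>a, \<phi>\<^sup>b) \<mapsto> \<phi> a b\<close> on \<open>\<phi>\<^sub>A \<times> \<phi>\<^sup>B\<close>.\<close>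

definition extends_sections ::
  "'a set \<Rightarrow> 'b set \<Rightarrow> ('a \<Rightarrow> 'b \<Rightarrow> real) \<Rightarrow> (('b \<Rightarrow> real) \<Rightarrow> ('a \<Rightarrow> real) \<Rightarrow> real) \<Rightarrow> bool" where
  "extends_sections A B \<phi> F \<longleftrightarrow>
    (\<forall>a\<in>A. \<forall>b\<in>B. F (section_at B \<phi> a) (section_at A (op_fun \<phi>) b) = \<phi> a b)"

text \<open>Only the values of \<open>F\<close> on the product of the two closed sets matter below, so
  uniqueness of an extension means agreement there.\<close>

definition continuous_extension ::
  "real set \<Rightarrow> 'a set \<Rightarrow> 'b set \<Rightarrow> ('a \<Rightarrow> 'b \<Rightarrow> real) \<Rightarrow>
   (('b \<Rightarrow> real) \<Rightarrow> ('a \<Rightarrow> real) \<Rightarrow> real) \<Rightarrow> bool" where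
  "continuous_extension I A B \<phi> F \<longleftrightarrow>
    F \<in> cl_sections A B \<phi> \<rightarrow> cl_sections B A (op_fun \<phi>) \<rightarrow> I \<and>
    extends_sections A B \<phi> F \<and>
    separately_continuous_on (powertop_real B) (powertop_real A)
      (cl_sections A B \<phi>) (cl_sections B A (op_fun \<phi>)) F"

definition continuous_affine_extension ::
  "real set \<Rightarrow> 'a set \<Rightarrow> 'b set \<Rightarrow> ('a \<Rightarrow> 'b \<Rightarrow> real) \<Rightarrow>
   (('b \<Rightarrow> real) \<Rightarrow> ('a \<Rightarrow> real) \<Rightarrow> real) \<Rightarrow> bool" where
  "continuous_affine_extension I A B \<phi> F \<longleftrightarrow>
    F \<in> cl_co_sections A B \<phi> \<rightarrow> cl_co_sections B A (op_fun \<phi>) \<rightarrow> I \<and>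
    extends_sections A B \<phi> F \<and>
    separately_continuous_on (powertop_real B) (powertop_real A)
      (cl_co_sections A B \<phi>) (cl_co_sections B A (op_fun \<phi>)) F \<and>
    separately_affine_on (cl_co_sections A B \<phi>) (cl_co_sections B A (op_fun \<phi>)) F"

end

theory Submission
  imports Defs "HOL-Complex_Analysis.Great_Picard"
begin

text \<open>The hard direction is that the double limit property makes every \<open>p\<close> in the closed convex hull of the
  sections uniformly approximable by averages. It combines Krein's theorem with Mazur's lemma, and
  the usual proofs go through integral representation and the separation of convex sets. The proof
  below avoids both and works with sequences and convex combinations only.

  Its core is \<open>simons_sequence\<close>, a sequential form of Simons' inequality. It yields Mazur's lemma for
  sequences (\<open>pointwise_limit_uniformly_approximable\<close>): if \<open>f n\<close> converges pointwise to \<open>p\<close> and the double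
  limit property holds, then some convex combination of the \<open>f n\<close> is uniformly close to \<open>p\<close>.
  Used with the roles of functions and points exchanged, this shows that the double limit property
  passes to convex hulls (\<open>double_limit_property_convex_hull\<close>, which is Krein's theorem). Used a second
  time, for the convex hull, it shows that the pointwise closure of the hull lies in its uniform closure
  (\<open>pointwise_closure_convex_hull_uniformly_approximable\<close>). The gap between nets and sequences is
  bridged there by a closing-off argument that builds a sequence together with a countable set of points
  on which it has to be tested. Finally, real weights are replaced by averages
  (\<open>convex_mean_definable\<close>).

  Conversely, mean-definability produces the extensions directly. If \<open>p\<close> and \<open>q\<close> are approximated by
  averages over lists \<open>xs\<close> and \<open>ys\<close>, then the mean of \<open>q\<close> over \<open>xs\<close> and the mean of \<open>p\<close> over \<open>ys\<close> are both
  close to the mean of \<open>\<phi>\<close> over all pairs. So they have a common limit \<open>mean_pairing A B \<phi> p q\<close>, which as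
  a uniform limit of means is continuous and affine in each variable.

  A separately continuous extension gives back the double limit property: at cluster points \<open>p\<close> and \<open>q\<close> of
  two sequences of sections, its value \<open>F p q\<close> is the iterated limit in either order. Uniqueness is
  density of the sections, used in one variable after the other.\<close>

section \<open>The double limit property\<close>

lemma double_limit_propertyD:
  assumes "double_limit_property A B \<phi>" and "\<And>n. a n \<in> A" and "\<And>m. b m \<in> B"
    and "\<And>n. (\<lambda>m. \<phi> (a n) (b m)) \<longlonglongrightarrow> x n" and "x \<longlonglongrightarrow> x'"
    and "\<And>m. (\<lambda>n. \<phi> (a n) (b m)) \<longlonglongrightarrow> y m" and "y \<longlonglongrightarrow> y'"
  shows "x' = y'"
proof -
  have *: "lim (\<lambda>m. \<phi> (a n) (b m)) = x n" "lim (\<lambda>n. \<phi> (a n) (b m)) = y m" for n m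
    using assms limI by blast+
  have "range a \<subseteq> A" "range b \<subseteq> B" using assms(2,3) by auto
  moreover have "\<forall>n. convergent (\<lambda>m. \<phi> (a n) (b m))" "\<forall>m. convergent (\<lambda>n. \<phi> (a n) (b m))"
    "convergent x" "convergent y"
    using assms convergentI by blast+
  ultimately have "lim x = lim y"
    using assms(1)[unfolded double_limit_property_def, rule_format, of a b] by (simp add: *)
  then show ?thesis using assms limI by metis
qed

lemma double_limit_propertyI:
  fixes A :: "'a set" and B :: "'b set"
  assumes "\<And>a b x y x' y'. \<lbrakk>\<And>n::nat. a n \<in> A; \<And>m::nat. b m \<in> B;
      \<And>n. (\<lambda>m. \<phi> (a n) (b m)) \<longlonglongrightarrow> x n; x \<longlonglongrightarrow> x';
      \<And>m. (\<lambda>n. \<phi> (a n) (b m)) \<longlonglongrightarrow> y m; y \<longlonglongrightarrow> y'\<rbrakk> \<Longrightarrow> x' = y'"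
  shows "double_limit_property A B \<phi>"
  unfolding double_limit_property_def
proof (intro allI impI)
  fix a :: "nat \<Rightarrow> 'a" and b :: "nat \<Rightarrow> 'b"
  assume "range a \<subseteq> A" "range b \<subseteq> B"
    and "\<forall>n. convergent (\<lambda>m. \<phi> (a n) (b m))" "convergent (\<lambda>n. lim (\<lambda>m. \<phi> (a n) (b m)))"
    and "\<forall>m. convergent (\<lambda>n. \<phi> (a n) (b m))" "convergent (\<lambda>m. lim (\<lambda>n. \<phi> (a n) (b m)))"
  then show "lim (\<lambda>n. lim (\<lambda>m. \<phi> (a n) (b m))) = lim (\<lambda>m. lim (\<lambda>n. \<phi> (a n) (b m)))"
    by (intro assms[of a b]) (auto simp: convergent_LIMSEQ_iff)
qed

text \<open>Stated for a change of variables on both sides, as the property is used for pairings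
  of functions with points that arise from \<open>\<phi>\<close> in this way.\<close>
lemma double_limit_property_reindex:
  assumes "double_limit_property A B \<phi>" and "\<And>x. x \<in> X \<Longrightarrow> f x \<in> A" and "\<And>y. y \<in> Y \<Longrightarrow> g y \<in> B"
  shows "double_limit_property X Y (\<lambda>x y. \<phi> (f x) (g y))"
proof (rule double_limit_propertyI)
  fix a b x y x' y'
  assume "\<And>n::nat. a n \<in> X" "\<And>m::nat. b m \<in> Y"
    and "\<And>n. (\<lambda>m. \<phi> (f (a n)) (g (b m))) \<longlonglongrightarrow> x n" "x \<longlonglongrightarrow> x'"
    and "\<And>m. (\<lambda>n. \<phi> (f (a n)) (g (b m))) \<longlonglongrightarrow> y m" "y \<longlonglongrightarrow> y'"
  then show "x' = y'"
    by (intro double_limit_propertyD[OF assms(1), of "\<lambda>n. f (a n)" "\<lambda>m. g (b m)" x x' y y'] assms(2,3))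
qed

lemma op_fun_apply: "op_fun \<phi> b a = \<phi> a b"
  by (simp add: op_fun_def)

lemma op_fun_op_fun [simp]: "op_fun (op_fun \<phi>) = \<phi>"
  by (simp add: op_fun_def)

lemma op_fun_in_PiI: "\<phi> \<in> A \<rightarrow> B \<rightarrow> I \<Longrightarrow> op_fun \<phi> \<in> B \<rightarrow> A \<rightarrow> I"
  by (auto simp: op_fun_def)

lemma double_limit_property_op:
  "double_limit_property B A (op_fun \<phi>) \<longleftrightarrow> double_limit_property A B \<phi>"
proof -
  have "double_limit_property B A (op_fun \<psi>)" if "double_limit_property A B \<psi>"
    for A :: "'x set" and B :: "'y set" and \<psi>
    by (rule double_limit_propertyI)
      (use double_limit_propertyD[OF that] in \<open>unfold op_fun_def, metis\<close>)
  from this[of A B \<phi>] this[of B A "op_fun \<phi>"] show ?thesis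
    by (auto simp: op_fun_def)
qed

section \<open>Convex hulls of sets of functions\<close>

lemma abs_convex_combination_le:
  fixes x y s t d :: real
  assumes "\<bar>x\<bar> \<le> d" "\<bar>y\<bar> \<le> d" "0 \<le> s" "0 \<le> t" "s + t = 1"
  shows "\<bar>s * x + t * y\<bar> \<le> d"
proof -
  have "\<bar>s * x + t * y\<bar> \<le> \<bar>s * x\<bar> + \<bar>t * y\<bar>" by (rule abs_triangle_ineq)
  also have "\<dots> = s * \<bar>x\<bar> + t * \<bar>y\<bar>" using assms by (simp add: abs_mult)
  also have "\<dots> \<le> d" using assms by (rule convex_bound_le)
  finally show ?thesis .
qed

lemma convex_hull_bounded:
  fixes S :: "('x \<Rightarrow> real) set"
  assumes "g \<in> convex hull S" and "\<And>f. f \<in> S \<Longrightarrow> f x \<in> {l..u}"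
  shows "g x \<in> {l..u}"
  using assms(1)
proof (rule hull_induct)
  show "convex {g::'x \<Rightarrow> real. g x \<in> {l..u}}"
  proof (rule convexI, clarify)
    fix f g :: "'x \<Rightarrow> real" and s t :: real
    assume *: "f x \<in> {l..u}" "g x \<in> {l..u}" "0 \<le> s" "0 \<le> t" "s + t = 1"
    have "s * f x + t * g x \<in> {l..u}"
      using convexD[OF convex_real_interval(5)[of l u], of "f x" "g x" s t] * by simp
    then show "(s *\<^sub>R f + t *\<^sub>R g) x \<in> {l..u}"
      by (simp add: scaleR_fun_def)
  qed
qed (use assms(2) in auto)

text \<open>Having a limit in a given interval along a fixed sequence of points is a convex condition on a
  function. This and the similar arguments below replace any explicit handling of coefficients of
  convex combinations.\<close>
lemma convex_hull_limit_in_interval: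
  fixes S :: "('x \<Rightarrow> real) set" and c :: "nat \<Rightarrow> 'x"
  assumes "g \<in> convex hull S" and "\<And>f. f \<in> S \<Longrightarrow> \<exists>L\<in>{l..u}. (\<lambda>j. f (c j)) \<longlonglongrightarrow> L"
  shows "\<exists>L\<in>{l..u}. (\<lambda>j. g (c j)) \<longlonglongrightarrow> L"
  using assms(1)
proof (rule hull_induct)
  show "convex {g::'x \<Rightarrow> real. \<exists>L\<in>{l..u}. (\<lambda>j. g (c j)) \<longlonglongrightarrow> L}"
  proof (rule convexI, clarify)
    fix f g :: "'x \<Rightarrow> real" and s t K L :: real
    assume *: "K \<in> {l..u}" "(\<lambda>j. f (c j)) \<longlonglongrightarrow> K" "L \<in> {l..u}" "(\<lambda>j. g (c j)) \<longlonglongrightarrow> L"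
      "0 \<le> s" "0 \<le> t" "s + t = 1"
    have "s * K + t * L \<in> {l..u}"
      using convexD[OF convex_real_interval(5)[of l u], of K L s t] * by simp
    moreover have "(\<lambda>j. (s *\<^sub>R f + t *\<^sub>R g) (c j)) \<longlonglongrightarrow> s * K + t * L"
      unfolding scaleR_fun_def plus_fun_apply real_scaleR_def by (intro tendsto_intros *)
    ultimately show "\<exists>L\<in>{l..u}. (\<lambda>j. (s *\<^sub>R f + t *\<^sub>R g) (c j)) \<longlonglongrightarrow> L"
      by blast
  qed
qed (use assms(2) in auto)

lemma convex_hull_finite_support:
  assumes "f \<in> convex hull S"
  shows "\<exists>T. finite T \<and> T \<subseteq> S \<and> f \<in> convex hull T"
  using assms
proof (rule hull_induct)
  fix x assume "x \<in> S"
  then show "\<exists>T. finite T \<and> T \<subseteq> S \<and> x \<in> convex hull T"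
    by (intro exI[of _ "{x}"]) auto
next
  show "convex {f. \<exists>T. finite T \<and> T \<subseteq> S \<and> f \<in> convex hull T}"
  proof (rule convexI, clarify)
    fix x y T U and u v :: real
    assume *: "finite T" "T \<subseteq> S" "x \<in> convex hull T" "finite U" "U \<subseteq> S" "y \<in> convex hull U"
      "0 \<le> u" "0 \<le> v" "u + v = 1"
    then have "x \<in> convex hull (T \<union> U)" "y \<in> convex hull (T \<union> U)"
      using hull_mono[of T "T \<union> U" convex] hull_mono[of U "T \<union> U" convex] by auto
    then have "u *\<^sub>R x + v *\<^sub>R y \<in> convex hull (T \<union> U)"
      using * convexD[OF convex_convex_hull] by blast
    then show "\<exists>T. finite T \<and> T \<subseteq> S \<and> u *\<^sub>R x + v *\<^sub>R y \<in> convex hull T"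
      using * by (intro exI[of _ "T \<union> U"]) auto
  qed
qed

text \<open>Here the members of the hull are functions on a vector space, typically evaluations at points,
  regarded as functions of a function.\<close>
lemma convex_hull_affine_in_argument:
  assumes "g \<in> convex hull S" and "s + t = 1"
    and "\<And>f. f \<in> S \<Longrightarrow> f (s *\<^sub>R x + t *\<^sub>R y) = s * f x + t * (f y :: real)"
  shows "g (s *\<^sub>R x + t *\<^sub>R y) = s * g x + t * g y"
  using assms(1)
proof (rule hull_induct)
  show "convex {g. g (s *\<^sub>R x + t *\<^sub>R y) = s * g x + t * (g y :: real)}"
    by (rule convexI) (simp add: scaleR_fun_def algebra_simps)
qed (use assms in auto)

section \<open>Simons' inequality along a sequence of points\<close>

lemma approximate_minimizer:
  fixes s :: "'z \<Rightarrow> real"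
  assumes "K \<noteq> {}" and "\<And>z. z \<in> K \<Longrightarrow> - L \<le> s z" and "\<epsilon> > 0"
  shows "\<exists>z\<in>K. \<forall>z'\<in>K. s z \<le> s z' + \<epsilon>"
proof -
  have bdd: "bdd_below (s ` K)"
    using assms(2) by (intro bdd_belowI2[of _ "- L"])
  have "(INF z\<in>K. s z) < (INF z\<in>K. s z) + \<epsilon>"
    using assms by simp
  then obtain z where "z \<in> K" "s z < (INF z\<in>K. s z) + \<epsilon>"
    using assms(1) by (subst (asm) cInf_less_iff) (use bdd in auto)
  moreover have "(INF z\<in>K. s z) \<le> s z'" if "z' \<in> K" for z'
    using that bdd by (auto intro: cINF_lower)
  ultimately show ?thesis
    by (metis add_le_cancel_right less_eq_real_def order_trans)
qed

text \<open>The summable loss \<open>\<eta> / 2 ^ n\<close> in the conclusion is what makes the induction close.\<close>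
lemma geometric_lower_bound:
  fixes w :: "nat \<Rightarrow> real"
  assumes "w 0 \<ge> \<delta> - \<eta>" and "\<eta> > 0"
    and "\<And>n. n < N \<Longrightarrow> w n \<le> 2 * w (Suc n) + 2 * (\<eta> / 4 ^ Suc n)"
    and "n \<le> N"
  shows "2 ^ n * w n \<ge> \<delta> - 2 * \<eta> + \<eta> / 2 ^ n"
  using \<open>n \<le> N\<close>
proof (induction n)
  case (Suc n)
  have "2 ^ n * w n \<le> 2 ^ n * (2 * w (Suc n) + 2 * (\<eta> / 4 ^ Suc n))"
    using assms(3)[of n] Suc.prems by (intro mult_left_mono) auto
  also have "\<dots> = 2 ^ Suc n * w (Suc n) + \<eta> / 2 ^ Suc n"
    by (simp add: field_simps flip: power_mult_distrib)
  finally have "2 ^ n * w n \<le> 2 ^ Suc n * w (Suc n) + \<eta> / 2 ^ Suc n" .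
  moreover have "\<eta> / 2 ^ n = 2 * (\<eta> / 2 ^ Suc n)" by simp
  ultimately show ?case using Suc by linarith
qed (use assms in simp)

text \<open>A sequential form of Simons' inequality. If every convex combination of the \<open>h n\<close> is at least \<open>\<delta>\<close>
  somewhere, then this is already visible on the individual functions, in the limit along a single
  sequence of points. It does here what the dominated convergence theorem does in the usual proof of
  Krein's theorem.

  The points come from a greedy construction. A series \<open>g 0 / 2 + g 1 / 4 + \<dots>\<close> is built with \<open>g n\<close> a
  convex combination of \<open>h n\<close>, \<open>h (Suc n)\<close>, \<open>\<dots>\<close>, where \<open>g n\<close> nearly minimizes the supremum of the
  partial sum with all the remaining weight on it. At a point where the sum is nearly maximal no tail
  of the series can be small: otherwise the preceding term would exceed the supremum that its
  minimality allows. So every tail, normalized to total weight one, is almost \<open>\<delta>\<close> at these points, and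
  so is some \<open>h m\<close> with \<open>m\<close> arbitrarily large.\<close>
proposition simons_sequence:
  fixes h :: "nat \<Rightarrow> 'x \<Rightarrow> real"
  assumes bound: "\<And>n x. x \<in> X \<Longrightarrow> \<bar>h n x\<bar> \<le> M"
    and large: "\<And>g. g \<in> convex hull (range h) \<Longrightarrow> \<exists>x\<in>X. \<delta> \<le> g x"
    and "\<delta>\<^sub>0 < \<delta>"
  obtains c :: "nat \<Rightarrow> 'x" where "range c \<subseteq> X"
    "\<And>r x n. strict_mono r \<Longrightarrow> (\<And>m. (\<lambda>j. h m (c (r j))) \<longlonglongrightarrow> x m) \<Longrightarrow> \<exists>m\<ge>n. \<delta>\<^sub>0 \<le> x m"
proof -
  define K where "K n = convex hull (h ` {n..})" for n :: nat
  define S where "S g = (SUP x\<in>X. g x)" for g :: "'x \<Rightarrow> real"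
  define \<eta> where "\<eta> = (\<delta> - \<delta>\<^sub>0) / 3"
  \<comment> \<open>The errors are later multiplied by 2 ^ n, so they have to decay faster than that.\<close>
  define \<epsilon> where "\<epsilon> n = \<eta> / 4 ^ Suc n" for n :: nat
  have \<eta>: "\<eta> > 0" using assms(3) by (simp add: \<eta>_def)
  have \<epsilon>: "\<epsilon> n > 0" for n using \<eta> by (simp add: \<epsilon>_def)
  have \<epsilon>_mono: "\<epsilon> m \<le> \<epsilon> n" if "n \<le> m" for m n
    using that \<eta> by (simp add: \<epsilon>_def frac_le)
  have K_ne: "K n \<noteq> {}" for n by (simp add: K_def)
  have K_anti: "K m \<subseteq> K n" if "n \<le> m" for m n
    unfolding K_def using that by (intro hull_mono image_mono) auto
  have K0: "K 0 = convex hull (range h)" by (simp add: K_def)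
  have K_bound: "\<bar>g x\<bar> \<le> M" if "g \<in> K n" "x \<in> X" for g n x
    using convex_hull_bounded[of g "h ` {n..}" x "- M" M] that bound
    by (fastforce simp: K_def abs_le_iff minus_le_iff)
  obtain x0 where x0: "x0 \<in> X" using large[of "h 0"] by (auto simp: hull_inc)
  have Xne: "X \<noteq> {}" using x0 by auto
  have bdd: "bdd_above (g ` X)" if "\<And>x. x \<in> X \<Longrightarrow> \<bar>g x\<bar> \<le> L" for g :: "'x \<Rightarrow> real" and L
    using that by (intro bdd_aboveI2[of _ _ L]) (auto simp: abs_le_iff)
  \<comment> \<open>u n v g is the partial sum v with the whole remaining weight 1 / 2 ^ n put on g.\<close>
  define u where "u n v g = v + (1 / 2 ^ n) *\<^sub>R g" for n and v g :: "'x \<Rightarrow> real"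
  have u_apply: "u n v g x = v x + g x / 2 ^ n" for n v g x
    by (simp add: u_def scaleR_fun_def)
  have u_bound: "\<bar>u n v g x\<bar> \<le> L + M" if "\<And>x. x \<in> X \<Longrightarrow> \<bar>v x\<bar> \<le> L" "g \<in> K m" "x \<in> X" for n m v g x L
  proof -
    have M: "\<bar>g x\<bar> \<le> M" using K_bound that by blast
    then have "0 \<le> M" by linarith
    have "\<bar>g x\<bar> / 2 ^ n \<le> M / 1"
      using M \<open>0 \<le> M\<close> by (intro frac_le) auto
    then have "\<bar>g x / 2 ^ n\<bar> \<le> M" by simp
    with that(1)[OF that(3)] show ?thesis unfolding u_apply by linarith
  qed
  have "\<exists>v. \<forall>n. (\<exists>L. \<forall>x\<in>X. \<bar>v n x\<bar> \<le> L) \<and> (n = 0 \<longrightarrow> v n = 0) \<and>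
    (\<exists>g\<in>K n. v (Suc n) = u (Suc n) (v n) g \<and>
         (\<forall>g'\<in>K n. S (u n (v n) g) \<le> S (u n (v n) g') + \<epsilon> n))"
  proof -
    have "\<exists>v. \<forall>n. ((\<exists>L. \<forall>x\<in>X. \<bar>v n x\<bar> \<le> L) \<and> (n = 0 \<longrightarrow> v n = 0)) \<and>
    (\<exists>g\<in>K n. v (Suc n) = u (Suc n) (v n) g \<and>
         (\<forall>g'\<in>K n. S (u n (v n) g) \<le> S (u n (v n) g') + \<epsilon> n))"
    proof (rule dependent_nat_choice)
      show "\<exists>v. (\<exists>L. \<forall>x\<in>X. \<bar>v x\<bar> \<le> L) \<and> ((0::nat) = 0 \<longrightarrow> v = (0 :: 'x \<Rightarrow> real))"
        by (rule exI[of _ 0]) auto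
    next
      fix v :: "'x \<Rightarrow> real" and n :: nat
      assume "(\<exists>L. \<forall>x\<in>X. \<bar>v x\<bar> \<le> L) \<and> (n = 0 \<longrightarrow> v = 0)"
      then obtain L where L: "\<And>x. x \<in> X \<Longrightarrow> \<bar>v x\<bar> \<le> L" by blast
      have "\<exists>g\<in>K n. \<forall>g'\<in>K n. S (u n v g) \<le> S (u n v g') + \<epsilon> n"
      proof (rule approximate_minimizer[OF K_ne])
        fix g assume "g \<in> K n"
        then have b: "\<bar>u n v g x\<bar> \<le> L + M" if "x \<in> X" for x
          using u_bound[where v = v and L = L, OF L] that by blast
        have "u n v g x0 \<le> S (u n v g)"
          unfolding S_def using x0 bdd[OF b] by (intro cSUP_upper) auto
        then show "- (L + M) \<le> S (u n v g)" using b[OF x0] by linarith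
      qed (rule \<epsilon>)
      then obtain g where g: "g \<in> K n" "\<forall>g'\<in>K n. S (u n v g) \<le> S (u n v g') + \<epsilon> n" by blast
      show "\<exists>v'. ((\<exists>L. \<forall>x\<in>X. \<bar>v' x\<bar> \<le> L) \<and> (Suc n = 0 \<longrightarrow> v' = 0)) \<and>
          (\<exists>g\<in>K n. v' = u (Suc n) v g \<and> (\<forall>g'\<in>K n. S (u n v g) \<le> S (u n v g') + \<epsilon> n))"
        using u_bound[where v = v and L = L, OF L g(1)] g by (intro exI[of _ "u (Suc n) v g"]) blast
    qed
    then show ?thesis by (simp only: conj_assoc)
  qed
  then obtain v where v_bound: "\<And>n. \<exists>L. \<forall>x\<in>X. \<bar>v n x\<bar> \<le> L" and v0: "v 0 = 0"
    and "\<And>n. \<exists>g\<in>K n. v (Suc n) = u (Suc n) (v n) g \<and>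
         (\<forall>g'\<in>K n. S (u n (v n) g) \<le> S (u n (v n) g') + \<epsilon> n)"
    by metis
  then obtain g where gK: "\<And>n. g n \<in> K n" and v_Suc: "\<And>n. v (Suc n) = u (Suc n) (v n) (g n)"
    and g_min: "\<And>n g'. g' \<in> K n \<Longrightarrow> S (u n (v n) (g n)) \<le> S (u n (v n) g') + \<epsilon> n"
    by metis
  define w where "w n = u n (v n) (g n)" for n
  have w_eq: "w n x = 2 * v (Suc n) x - v n x" for n x
    by (simp add: w_def v_Suc u_apply)
  have w_bdd: "bdd_above (w n ` X)" for n
  proof -
    obtain L where "\<And>x. x \<in> X \<Longrightarrow> \<bar>v n x\<bar> \<le> L" using v_bound by blast
    then show ?thesis
      unfolding w_def using u_bound[where v = "v n" and L = L, OF _ gK] by (intro bdd) blast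
  qed
  \<comment> \<open>Each later term w N is itself a candidate in the minimization that produced g n, because the
    tail of the series is a repeated midpoint of members of K n.\<close>
  have tail: "\<exists>e\<in>K n. w N = u n (v n) e" if "n \<le> N" for n N
    using that
  proof (induction n rule: inc_induct)
    case base
    show ?case using gK w_def by blast
  next
    case (step n)
    then obtain e where e: "e \<in> K (Suc n)" "w N = u (Suc n) (v (Suc n)) e" by blast
    have "(1/2) *\<^sub>R g n + (1/2) *\<^sub>R e \<in> K n"
      using gK[of n] e(1) K_anti[of n "Suc n"] convex_convex_hull[of "h ` {n..}"]
      by (intro convexD) (auto simp: K_def)
    moreover have "w N = u n (v n) ((1/2) *\<^sub>R g n + (1/2) *\<^sub>R e)"
      unfolding e(2) by (rule ext) (simp add: u_apply v_Suc scaleR_fun_def field_simps)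
    ultimately show ?case by blast
  qed
  have "\<exists>x\<in>X. S (w N) - \<epsilon> N < w N x" for N
    using less_cSUP_iff[OF Xne w_bdd, of "S (w N) - \<epsilon> N" N] \<epsilon>[of N] by (simp add: S_def)
  then obtain c where cX: "\<And>N. c N \<in> X" and c: "\<And>N. S (w N) - \<epsilon> N < w N (c N)"
    by metis
  \<comment> \<open>The left side is the value at c N of the normalized tail of the series from n on. Minimality of
    g n says that w n exceeds w N nowhere by much, and w n = 2 * v (Suc n) - v n turns this into a
    recursive inequality for the tails.\<close>
  have lower: "2 ^ n * (w N (c N) - v n (c N)) \<ge> \<delta> - 2 * \<eta>" if "n \<le> N" for n N
  proof -
    have "w N \<in> K 0" using tail[of 0 N] v0 by (auto simp: u_def)
    then obtain x where x: "x \<in> X" "\<delta> \<le> w N x" using large K0 by blast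
    then have "\<delta> \<le> S (w N)"
      unfolding S_def using w_bdd by (meson cSUP_upper order_trans)
    moreover have "\<epsilon> N \<le> \<eta>" using \<epsilon>_mono[of 0 N] \<eta> by (simp add: \<epsilon>_def)
    ultimately have 0: "w N (c N) - v 0 (c N) \<ge> \<delta> - \<eta>"
      using c[of N] by (simp add: v0)
    have step: "w N (c N) - v n (c N) \<le> 2 * (w N (c N) - v (Suc n) (c N)) + 2 * (\<eta> / 4 ^ Suc n)"
      if "n < N" for n
    proof -
      obtain e where "e \<in> K n" "w N = u n (v n) e" using tail \<open>n < N\<close> by (meson less_imp_le)
      then have "S (w n) \<le> S (w N) + \<epsilon> n" using g_min[of e n] by (simp add: w_def)
      moreover have "w n (c N) \<le> S (w n)"
        unfolding S_def using w_bdd cX by (intro cSUP_upper) auto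
      moreover have "\<epsilon> N \<le> \<epsilon> n" using \<epsilon>_mono that by simp
      ultimately have "w n (c N) \<le> w N (c N) + 2 * \<epsilon> n" using c[of N] by linarith
      then have "w N (c N) - v n (c N) \<le> 2 * (w N (c N) - v (Suc n) (c N)) + 2 * \<epsilon> n"
        unfolding w_eq[of n] by argo
      then show ?thesis unfolding \<epsilon>_def .
    qed
    have "\<delta> - 2 * \<eta> + \<eta> / 2 ^ n \<le> 2 ^ n * (w N (c N) - v n (c N))"
      by (rule geometric_lower_bound[OF 0 \<eta> step that])
    moreover have "\<eta> / 2 ^ n \<ge> 0" using \<eta> by simp
    ultimately show ?thesis by linarith
  qed
  show thesis
  proof
    show "range c \<subseteq> X" using cX by auto
  next
    fix r x and n :: nat
    assume r: "strict_mono (r :: nat \<Rightarrow> nat)" and lim: "\<And>m. (\<lambda>j. h m (c (r j))) \<longlonglongrightarrow> x m"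
    show "\<exists>m\<ge>n. \<delta>\<^sub>0 \<le> x m"
    proof (rule ccontr)
      assume "\<not> ?thesis"
      then have small: "x m < \<delta>\<^sub>0" if "m \<ge> n" for m using that by force
      have x_bound: "- M \<le> x m" for m
      proof (rule LIMSEQ_le_const[OF lim])
        show "\<exists>N. \<forall>j\<ge>N. - M \<le> h m (c (r j))"
          using bound[OF cX] by (auto simp: abs_le_iff minus_le_iff)
      qed
      have g_lim: "\<exists>L\<in>{-M..\<delta>\<^sub>0}. (\<lambda>j. g k (c (r j))) \<longlonglongrightarrow> L" if "k \<ge> n" for k
      proof (rule convex_hull_limit_in_interval[of _ "h ` {k..}"])
        show "g k \<in> convex hull (h ` {k..})" using gK by (simp add: K_def)
      next
        fix f assume "f \<in> h ` {k..}"
        then obtain m where "m \<ge> k" "f = h m" by blast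
        then show "\<exists>L\<in>{-M..\<delta>\<^sub>0}. (\<lambda>j. f (c (r j))) \<longlonglongrightarrow> L"
          using lim small[of m] x_bound[of m] that by (intro bexI[of _ "x m"]) auto
      qed
      \<comment> \<open>If all limits x m with m \<ge> n were below the threshold, so would be the limits of the g k for
        k \<ge> n, hence the tail from n on, contradicting the bound just proved.\<close>
      have v_lim: "\<exists>L. (\<lambda>j. v k (c (r j)) - v n (c (r j))) \<longlonglongrightarrow> L \<and> L \<le> (1 / 2 ^ n - 1 / 2 ^ k) * \<delta>\<^sub>0"
        if "k \<ge> n" for k
        using that
      proof (induction k rule: dec_induct)
        case base
        show ?case by (intro exI[of _ 0]) simp
      next
        case (step k)
        then obtain L where L: "(\<lambda>j. v k (c (r j)) - v n (c (r j))) \<longlonglongrightarrow> L"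
          "L \<le> (1 / 2 ^ n - 1 / 2 ^ k) * \<delta>\<^sub>0" by blast
        obtain L' where L': "(\<lambda>j. g k (c (r j))) \<longlonglongrightarrow> L'" "L' \<le> \<delta>\<^sub>0"
          using g_lim[of k] step by auto
        have "(\<lambda>j. (v k (c (r j)) - v n (c (r j))) + g k (c (r j)) / 2 ^ Suc k) \<longlonglongrightarrow> L + L' / 2 ^ Suc k"
          by (intro tendsto_intros L L') simp
        moreover have "L + L' / 2 ^ Suc k \<le> (1 / 2 ^ n - 1 / 2 ^ Suc k) * \<delta>\<^sub>0"
        proof -
          have "L' / 2 ^ Suc k \<le> \<delta>\<^sub>0 / 2 ^ Suc k" using L'(2) by (intro divide_right_mono) auto
          moreover have "(1 / 2 ^ n - 1 / 2 ^ k) * \<delta>\<^sub>0 + \<delta>\<^sub>0 / 2 ^ Suc k = (1 / 2 ^ n - 1 / 2 ^ Suc k) * \<delta>\<^sub>0"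
            by (simp add: field_simps)
          ultimately show ?thesis using L(2) by linarith
        qed
        ultimately show ?case
          by (intro exI[of _ "L + L' / 2 ^ Suc k"]) (simp add: v_Suc u_apply algebra_simps)
      qed
      have key: "(\<delta> - 2 * \<eta>) / 2 ^ n - M / 2 ^ k \<le> (1 / 2 ^ n - 1 / 2 ^ k) * \<delta>\<^sub>0" if "k \<ge> n" for k
      proof -
        obtain L where L: "(\<lambda>j. v k (c (r j)) - v n (c (r j))) \<longlonglongrightarrow> L"
          "L \<le> (1 / 2 ^ n - 1 / 2 ^ k) * \<delta>\<^sub>0" using v_lim \<open>k \<ge> n\<close> by blast
        have "(\<delta> - 2 * \<eta>) / 2 ^ n - M / 2 ^ k \<le> L"
        proof (rule LIMSEQ_le_const[OF L(1)], intro exI allI impI)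
          fix j assume "k \<le> j"
          then have kj: "k \<le> r j" using strict_mono_imp_increasing[OF r, of j] by linarith
          let ?c = "c (r j)"
          obtain e where e: "e \<in> K k" "w (r j) = u k (v k) e" using tail kj by blast
          have "e ?c / 2 ^ k \<le> M / 2 ^ k"
            using K_bound[OF e(1) cX[of "r j"]] by (intro divide_right_mono) auto
          then have "w (r j) ?c \<le> v k ?c + M / 2 ^ k" by (simp add: e(2) u_apply)
          moreover have "(\<delta> - 2 * \<eta>) / 2 ^ n \<le> w (r j) ?c - v n ?c"
            using lower[of n "r j"] kj that by (simp add: field_simps)
          ultimately show "(\<delta> - 2 * \<eta>) / 2 ^ n - M / 2 ^ k \<le> v k ?c - v n ?c" by linarith
        qed
        with L(2) show ?thesis by linarith
      qed
      have z: "(\<lambda>k. a / 2 ^ k) \<longlonglongrightarrow> 0" for a :: real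
        using tendsto_mult[OF tendsto_const[of a] LIMSEQ_inverse_realpow_zero[of 2]]
        by (simp add: divide_inverse)
      have "(\<delta> - 2 * \<eta>) / 2 ^ n - 0 \<le> (1 / 2 ^ n - 0) * \<delta>\<^sub>0"
      proof (rule LIMSEQ_le)
        show "(\<lambda>k. (\<delta> - 2 * \<eta>) / 2 ^ n - M / 2 ^ k) \<longlonglongrightarrow> (\<delta> - 2 * \<eta>) / 2 ^ n - 0"
          by (intro tendsto_intros z)
        show "(\<lambda>k. (1 / 2 ^ n - 1 / 2 ^ k) * \<delta>\<^sub>0) \<longlonglongrightarrow> (1 / 2 ^ n - 0) * \<delta>\<^sub>0"
          by (intro tendsto_intros z)
      qed (use key in blast)
      then have "\<delta> - 2 * \<eta> \<le> \<delta>\<^sub>0" by (simp add: divide_le_cancel)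
      moreover have "\<delta> - 2 * \<eta> = \<delta>\<^sub>0 + \<eta>" by (simp add: \<eta>_def field_simps)
      ultimately show False using \<eta> by linarith
    qed
  qed
qed

section \<open>The lemma of Mazur and the theorem of Krein\<close>

text \<open>Mazur's lemma for a pointwise convergent sequence, with the double limit property in the place of
  weak convergence. If no convex combination of the \<open>f n\<close> is uniformly close to \<open>p\<close>, the
  previous proposition gives points \<open>c j\<close> at which infinitely many of the limits of \<open>f m (c j)\<close> as
  \<open>j\<close> grows stay away from the limit \<open>P\<close> of \<open>p (c j)\<close>. But \<open>P\<close> is the limit of these values in the
  other order, so the double limit property is violated.\<close>
lemma pointwise_limit_uniformly_approximable:
  fixes f :: "nat \<Rightarrow> 'c \<Rightarrow> real"
  assumes dlp: "double_limit_property UNIV C f"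
    and bound: "\<And>n c. c \<in> C \<Longrightarrow> \<bar>f n c\<bar> \<le> M"
    and lim: "\<And>c. c \<in> C \<Longrightarrow> (\<lambda>n. f n c) \<longlonglongrightarrow> p c"
    and "\<delta> > 0"
  shows "\<exists>g\<in>convex hull (range f). \<forall>c\<in>C. \<bar>g c - p c\<bar> \<le> \<delta>"
proof (rule ccontr)
  assume contra: "\<not> ?thesis"
  \<comment> \<open>The sign s makes a one-sided supremum of h control the absolute value of f n - p.\<close>
  define h where "h n = (\<lambda>(c, s). s * (f n c - p c))" for n
  have p_bound: "\<bar>p c\<bar> \<le> M" if "c \<in> C" for c
    using bound[OF that] by (intro LIMSEQ_le_const2[OF tendsto_rabs[OF lim[OF that]]]) auto
  have hull_h: "\<exists>g'\<in>convex hull (range f). g = (\<lambda>(c, s). s * (g' c - p c))"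
    if "g \<in> convex hull (range h)" for g
    using that
  proof (rule hull_induct)
    show "convex {g. \<exists>g'\<in>convex hull (range f). g = (\<lambda>(c, s). s * (g' c - p c))}"
    proof (rule convexI, clarify)
      fix g1 g2 :: "'c \<Rightarrow> real" and s t :: real
      assume *: "g1 \<in> convex hull (range f)" "g2 \<in> convex hull (range f)" "0 \<le> s" "0 \<le> t" "s + t = 1"
      have "s *\<^sub>R g1 + t *\<^sub>R g2 \<in> convex hull (range f)"
        using * convexD[OF convex_convex_hull] by blast
      moreover have "s *\<^sub>R (\<lambda>(c, r). r * (g1 c - p c)) + t *\<^sub>R (\<lambda>(c, r). r * (g2 c - p c))
          = (\<lambda>(c, r). r * ((s *\<^sub>R g1 + t *\<^sub>R g2) c - p c))"
      proof (rule ext, clarify)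
        fix c r
        have "p c = s * p c + t * p c" using *(5) by (metis distrib_right mult_1)
        then have "r * ((s *\<^sub>R g1 + t *\<^sub>R g2) c - p c)
            = r * ((s * g1 c + t * g2 c) - (s * p c + t * p c))"
          by (simp add: scaleR_fun_def)
        also have "\<dots> = s * (r * (g1 c - p c)) + t * (r * (g2 c - p c))"
          by (simp add: algebra_simps)
        finally show "(s *\<^sub>R (\<lambda>(c, r). r * (g1 c - p c)) + t *\<^sub>R (\<lambda>(c, r). r * (g2 c - p c))) (c, r)
          = r * ((s *\<^sub>R g1 + t *\<^sub>R g2) c - p c)"
          by (simp add: scaleR_fun_def)
      qed
      ultimately show "\<exists>g'\<in>convex hull (range f). s *\<^sub>R (\<lambda>(c, r). r * (g1 c - p c))
          + t *\<^sub>R (\<lambda>(c, r). r * (g2 c - p c)) = (\<lambda>(c, r). r * (g' c - p c))" by blast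
    qed
  qed (auto simp: h_def intro: hull_inc)
  have h_bound: "\<bar>h n x\<bar> \<le> 2 * M" if "x \<in> C \<times> {1, - 1}" for n x
    using bound[of "fst x" n] p_bound[of "fst x"] that by (auto simp: h_def)
  have h_large: "\<exists>x\<in>C \<times> {1, - 1}. \<delta> \<le> g x" if hull: "g \<in> convex hull (range h)" for g
  proof -
    obtain g' where g': "g' \<in> convex hull (range f)" "g = (\<lambda>(c, s). s * (g' c - p c))"
      using hull_h[OF hull] by blast
    then obtain c where c: "c \<in> C" "\<bar>g' c - p c\<bar> > \<delta>" using contra by force
    then show ?thesis
      by (intro bexI[of _ "(c, if g' c - p c \<ge> 0 then 1 else - 1)"]) (auto simp: g'(2))
  qed
  have "\<delta> / 2 < \<delta>" using \<open>\<delta> > 0\<close> by simp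
  then obtain c :: "nat \<Rightarrow> 'c \<times> real" where c: "range c \<subseteq> C \<times> {1, - 1}"
    and large: "\<And>r x n. strict_mono r \<Longrightarrow> (\<And>m. (\<lambda>j. h m (c (r j))) \<longlonglongrightarrow> x m) \<Longrightarrow> \<exists>m\<ge>n. \<delta> / 2 \<le> x m"
    using simons_sequence[of "C \<times> {1, - 1}" h, OF h_bound h_large, where \<delta>\<^sub>0 = "\<delta> / 2"] by metis
  define d where "d N = fst (c N)" for N
  have cN: "c N \<in> C \<times> {1, - 1}" for N using c by blast
  have dC: "d N \<in> C" and sgn: "\<bar>snd (c N)\<bar> = 1" for N
    using cN[of N] by (auto simp: d_def mem_Times_iff)
  \<comment> \<open>One diagonal extraction makes p, the sign and every f m converge along d.\<close>
  define F where "F N i = (case i of 0 \<Rightarrow> p (d N) | Suc 0 \<Rightarrow> snd (c N) | Suc (Suc m) \<Rightarrow> f m (d N))" for N i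
  have "\<exists>r. strict_mono r \<and> (\<forall>i. \<exists>L. (\<lambda>N. F (r N) i) \<longlonglongrightarrow> L)"
  proof -
    have "norm (F N i) \<le> max M 1" for N i
      using bound[OF dC] p_bound[OF dC] sgn by (auto simp: F_def le_max_iff_disj split: nat.split)
    then show ?thesis
      using function_convergent_subsequence[of UNIV F "max M 1"] by (metis UNIV_I countableI_type)
  qed
  then obtain r where r: "strict_mono r" and conv: "\<And>i. \<exists>L. (\<lambda>N. F (r N) i) \<longlonglongrightarrow> L" by blast
  obtain P where P: "(\<lambda>N. p (d (r N))) \<longlonglongrightarrow> P" using conv[of 0] by (auto simp: F_def)
  obtain s where s: "(\<lambda>N. snd (c (r N))) \<longlonglongrightarrow> s" using conv[of 1] by (auto simp: F_def)
  have "\<exists>L. (\<lambda>N. f m (d (r N))) \<longlonglongrightarrow> L" for m using conv[of "Suc (Suc m)"] by (auto simp: F_def)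
  then obtain y where y: "\<And>m. (\<lambda>N. f m (d (r N))) \<longlonglongrightarrow> y m" by metis
  have "\<bar>s\<bar> = 1"
    using LIMSEQ_unique[OF tendsto_rabs[OF s]] sgn by simp
  have "\<exists>m\<ge>n. \<delta> / 2 \<le> \<bar>y m - P\<bar>" for n
  proof -
    have "(\<lambda>j. h m (c (r j))) \<longlonglongrightarrow> s * (y m - P)" for m
      unfolding h_def case_prod_unfold using s y[of m] P by (auto simp: d_def intro!: tendsto_intros)
    from large[OF r this] obtain m where "m \<ge> n" "\<delta> / 2 \<le> s * (y m - P)" by blast
    moreover have "s * (y m - P) \<le> \<bar>y m - P\<bar>"
      using \<open>\<bar>s\<bar> = 1\<close> abs_ge_self[of "s * (y m - P)"] by (simp add: abs_mult)
    ultimately show ?thesis by (meson order_trans)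
  qed
  then have "infinite {m. \<delta> / 2 \<le> \<bar>y m - P\<bar>}"
    unfolding infinite_nat_iff_unbounded_le by blast
  then obtain k0 :: "nat \<Rightarrow> nat" where k0: "strict_mono k0" "\<And>i. \<delta> / 2 \<le> \<bar>y (k0 i) - P\<bar>"
    using infinite_enumerate[of "{m. \<delta> / 2 \<le> \<bar>y m - P\<bar>}"] by blast
  have "\<bar>y m\<bar> \<le> M" for m
    using bound[OF dC] by (intro LIMSEQ_le_const2[OF tendsto_rabs[OF y]]) auto
  then have "bounded (range (y \<circ> k0))" by (intro boundedI[of _ M]) auto
  then obtain Y and k1 :: "nat \<Rightarrow> nat" where k1: "strict_mono k1" "(y \<circ> k0 \<circ> k1) \<longlonglongrightarrow> Y"
    using bounded_imp_convergent_subsequence by blast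
  define k where "k = k0 \<circ> k1"
  have k: "strict_mono k" "(\<lambda>i. y (k i)) \<longlonglongrightarrow> Y" "\<And>i. \<delta> / 2 \<le> \<bar>y (k i) - P\<bar>"
    using k0 k1 strict_mono_o by (auto simp: k_def o_def)
  have "\<delta> / 2 \<le> \<bar>Y - P\<bar>"
    using k(3) by (intro LIMSEQ_le_const[OF tendsto_rabs[OF tendsto_diff[OF k(2) tendsto_const]]]) auto
  moreover have "Y = P"
  proof (rule double_limit_propertyD[OF dlp, of k "\<lambda>j. d (r j)" "\<lambda>i. y (k i)" _ "\<lambda>j. p (d (r j))"])
    fix j
    show "(\<lambda>n. f (k n) (d (r j))) \<longlonglongrightarrow> p (d (r j))"
      using LIMSEQ_subseq_LIMSEQ[OF lim[OF dC] k(1)] by (simp add: o_def)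
  qed (use y k P dC in auto)
  ultimately show False using \<open>\<delta> > 0\<close> by simp
qed

text \<open>Krein's theorem in the language of double limits. Only countably many members of \<open>\<Phi>\<close> are involved
  in a given sequence from the hull, so the points can be taken to converge on all of them, and
  Mazur's lemma applies with the roles of functions and points exchanged.\<close>
proposition double_limit_property_convex_hull:
  fixes \<Phi> :: "('b \<Rightarrow> real) set"
  assumes dlp: "double_limit_property \<Phi> B (\<lambda>f. f)"
    and bound: "\<And>f b. f \<in> \<Phi> \<Longrightarrow> b \<in> B \<Longrightarrow> \<bar>f b\<bar> \<le> M"
  shows "double_limit_property (convex hull \<Phi>) B (\<lambda>f. f)"
proof (rule double_limit_propertyI)
  fix f :: "nat \<Rightarrow> 'b \<Rightarrow> real" and b x y x' y'
  assume f: "\<And>n. f n \<in> convex hull \<Phi>" and b: "\<And>m::nat. b m \<in> B"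
    and x: "\<And>n. (\<lambda>m. f n (b m)) \<longlonglongrightarrow> x n" and x': "x \<longlonglongrightarrow> x'"
    and y: "\<And>m. (\<lambda>n. f n (b m)) \<longlonglongrightarrow> y m" and y': "y \<longlonglongrightarrow> y'"
  have "\<forall>n. \<exists>T. finite T \<and> T \<subseteq> \<Phi> \<and> f n \<in> convex hull T"
    using f convex_hull_finite_support by blast
  then obtain T where T: "\<And>n. finite (T n)" "\<And>n. T n \<subseteq> \<Phi>" "\<And>n. f n \<in> convex hull T n"
    by metis
  define A where "A = (\<Union>n. T n)"
  have A: "countable A" "A \<subseteq> \<Phi>" using T by (auto simp: A_def countable_finite)
  have fA: "f n \<in> convex hull A" for n using T(3) hull_mono[of "T n" A] by (auto simp: A_def)
  obtain r where r: "strict_mono r" and "\<And>a. a \<in> A \<Longrightarrow> \<exists>L. (\<lambda>m. a (b (r m))) \<longlonglongrightarrow> L"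
    using function_convergent_subsequence[OF A(1), of "\<lambda>m a. a (b m)" M] bound b A(2)
    by (auto simp: subset_iff)
  then obtain q where q: "\<And>a. a \<in> A \<Longrightarrow> (\<lambda>m. a (b (r m))) \<longlonglongrightarrow> q a" by metis
  \<comment> \<open>The evaluations at the points b (r m) converge pointwise on A, so some convex combination g of
    late ones is uniformly within \<delta> of the limit q on A. Being affine, g keeps this property on
    the convex hull of A, and so g (f n) is within \<delta> of x n; as a combination of late evaluations it
    is also within \<delta> of y' in the limit.\<close>
  have close: "\<bar>x' - y'\<bar> \<le> 2 * \<delta>" if "\<delta> > 0" for \<delta>
  proof -
    obtain N where N: "\<And>m. m \<ge> N \<Longrightarrow> \<bar>y m - y'\<bar> < \<delta>"
      using y' \<open>\<delta> > 0\<close> by (auto simp: LIMSEQ_iff)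
    define c where "c m = b (r (m + N))" for m
    define F where "F m = (\<lambda>a :: 'b \<Rightarrow> real. a (c m))" for m
    have rN: "strict_mono (\<lambda>m. r (m + N))" using r by (simp add: strict_mono_def)
    have "double_limit_property B \<Phi> (op_fun (\<lambda>f. f))"
      using dlp by (simp add: double_limit_property_op)
    then have "double_limit_property UNIV A (\<lambda>m a. op_fun (\<lambda>f. f) (c m) a)"
      by (rule double_limit_property_reindex[where f = c and g = "\<lambda>a. a"]) (use b A(2) in \<open>auto simp: c_def\<close>)
    then have "double_limit_property UNIV A F" by (simp add: F_def[abs_def] op_fun_def)
    moreover have "\<bar>F m a\<bar> \<le> M" if "a \<in> A" for m a
      using that A(2) b bound by (auto simp: F_def c_def)
    moreover have "(\<lambda>m. F m a) \<longlonglongrightarrow> q a" if "a \<in> A" for a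
      using LIMSEQ_ignore_initial_segment[OF q[OF that], of N] by (simp add: F_def c_def)
    ultimately obtain g where g: "g \<in> convex hull (range F)" "\<And>a. a \<in> A \<Longrightarrow> \<bar>g a - q a\<bar> \<le> \<delta>"
      using pointwise_limit_uniformly_approximable[of A F M q \<delta>] \<open>\<delta> > 0\<close> by blast
    have "\<exists>L. (\<lambda>m. h (c m)) \<longlonglongrightarrow> L \<and> \<bar>g h - L\<bar> \<le> \<delta>" if "h \<in> convex hull A" for h
      using that
    proof (rule hull_induct)
      fix a assume "a \<in> A"
      then show "\<exists>L. (\<lambda>m. a (c m)) \<longlonglongrightarrow> L \<and> \<bar>g a - L\<bar> \<le> \<delta>"
        using LIMSEQ_ignore_initial_segment[OF q, of a N] g(2) by (auto simp: c_def)
    next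
      show "convex {h. \<exists>L. (\<lambda>m. h (c m)) \<longlonglongrightarrow> L \<and> \<bar>g h - L\<bar> \<le> \<delta>}"
      proof (rule convexI, clarify)
        fix h k :: "'b \<Rightarrow> real" and H K s t :: real
        assume *: "(\<lambda>m. h (c m)) \<longlonglongrightarrow> H" "\<bar>g h - H\<bar> \<le> \<delta>" "(\<lambda>m. k (c m)) \<longlonglongrightarrow> K"
          "\<bar>g k - K\<bar> \<le> \<delta>" "0 \<le> s" "0 \<le> t" "s + t = 1"
        have "(\<lambda>m. (s *\<^sub>R h + t *\<^sub>R k) (c m)) \<longlonglongrightarrow> s * H + t * K"
          unfolding scaleR_fun_def plus_fun_apply real_scaleR_def by (intro tendsto_intros *)
        moreover have "g (s *\<^sub>R h + t *\<^sub>R k) = s * g h + t * g k"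
          by (rule convex_hull_affine_in_argument[OF g(1) *(7)]) (auto simp: F_def scaleR_fun_def)
        then have "g (s *\<^sub>R h + t *\<^sub>R k) - (s * H + t * K) = s * (g h - H) + t * (g k - K)"
          by (simp add: algebra_simps)
        moreover have "\<bar>s * (g h - H) + t * (g k - K)\<bar> \<le> \<delta>"
          using * by (intro abs_convex_combination_le)
        ultimately show "\<exists>L. (\<lambda>m. (s *\<^sub>R h + t *\<^sub>R k) (c m)) \<longlonglongrightarrow> L \<and> \<bar>g (s *\<^sub>R h + t *\<^sub>R k) - L\<bar> \<le> \<delta>"
          by metis
      qed
    qed
    then have gx: "\<bar>g (f n) - x n\<bar> \<le> \<delta>" for n
      using LIMSEQ_unique[OF _ LIMSEQ_subseq_LIMSEQ[OF x[of n] rN]] fA[of n]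
      by (fastforce simp: c_def o_def)
    have "\<exists>L\<in>{y' - \<delta>..y' + \<delta>}. (\<lambda>n. g (f n)) \<longlonglongrightarrow> L"
    proof (rule convex_hull_limit_in_interval[OF g(1)])
      fix h assume "h \<in> range F"
      then obtain m where h: "h = F m" by blast
      have "m + N \<le> r (m + N)" using strict_mono_imp_increasing[OF r] .
      then have "\<bar>y (r (m + N)) - y'\<bar> < \<delta>" using N by simp
      then show "\<exists>L\<in>{y' - \<delta>..y' + \<delta>}. (\<lambda>n. h (f n)) \<longlonglongrightarrow> L"
        using y[of "r (m + N)"] by (intro bexI[of _ "y (r (m + N))"]) (auto simp: h F_def c_def)
    qed
    then obtain L where L: "L \<in> {y' - \<delta>..y' + \<delta>}" "(\<lambda>n. g (f n)) \<longlonglongrightarrow> L"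
      by blast
    have "\<bar>L - x'\<bar> \<le> \<delta>"
      using gx by (intro LIMSEQ_le_const2[OF tendsto_rabs[OF tendsto_diff[OF L(2) x']]]) auto
    then show ?thesis using L(1) by (simp add: abs_le_iff)
  qed
  show "x' = y'"
  proof (rule ccontr)
    assume "x' \<noteq> y'"
    then show False using close[of "\<bar>x' - y'\<bar> / 4"] by simp
  qed
qed

section \<open>Averages over lists\<close>

definition list_mean :: "'a list \<Rightarrow> ('a \<Rightarrow> real) \<Rightarrow> real" where
  "list_mean xs f = (\<Sum>x\<leftarrow>xs. f x) / length xs"

lemma list_mean_diff_le:
  assumes "xs \<noteq> []" and "\<And>x. x \<in> set xs \<Longrightarrow> \<bar>f x - g x\<bar> \<le> d"
  shows "\<bar>list_mean xs f - list_mean xs g\<bar> \<le> d"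
proof -
  have "\<bar>(\<Sum>x\<leftarrow>xs. f x) - (\<Sum>x\<leftarrow>xs. g x)\<bar> \<le> length xs * d"
    using assms(2)
  proof (induction xs)
    case (Cons x xs)
    then have "\<bar>f x - g x\<bar> \<le> d" "\<bar>(\<Sum>x\<leftarrow>xs. f x) - (\<Sum>x\<leftarrow>xs. g x)\<bar> \<le> length xs * d"
      by auto
    then show ?case by (simp add: algebra_simps)
  qed simp
  then show ?thesis
    using assms(1) by (simp add: list_mean_def divide_simps mult.commute flip: diff_divide_distrib)
qed

lemma list_mean_swap:
  "list_mean xs (\<lambda>a. list_mean ys (\<lambda>b. f a b)) = list_mean ys (\<lambda>b. list_mean xs (\<lambda>a. f a b))"
proof -
  have divide: "(\<Sum>x\<leftarrow>zs. g x / c) = (\<Sum>x\<leftarrow>zs. g x) / c" for zs :: "'x list" and g and c :: real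
    by (induction zs) (auto simp: add_divide_distrib)
  have "(\<Sum>a\<leftarrow>xs. \<Sum>b\<leftarrow>ys. f a b) = (\<Sum>b\<leftarrow>ys. \<Sum>a\<leftarrow>xs. f a b)"
    by (induction xs) (auto simp: sum_list_addf)
  then show ?thesis
    by (simp add: list_mean_def divide mult.commute)
qed

lemma list_mean_const: "xs \<noteq> [] \<Longrightarrow> list_mean xs (\<lambda>_. c) = c"
  by (simp add: list_mean_def sum_list_triv)

lemma list_mean_linear:
  "list_mean xs (s *\<^sub>R f + t *\<^sub>R g) = s * list_mean xs f + t * list_mean xs g"
proof -
  have "(\<Sum>x\<leftarrow>xs. s * f x + t * g x) = s * (\<Sum>x\<leftarrow>xs. f x) + t * (\<Sum>x\<leftarrow>xs. g x)"
    by (simp add: sum_list_addf sum_list_const_mult)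
  then show ?thesis
    by (simp add: list_mean_def scaleR_fun_def plus_fun_def add_divide_distrib)
qed

lemma list_mean_in_interval:
  assumes "xs \<noteq> []" and "\<And>x. x \<in> set xs \<Longrightarrow> f x \<in> {l..u}"
  shows "list_mean xs f \<in> {l..u}"
proof -
  have "\<bar>list_mean xs f - list_mean xs (\<lambda>_. (l + u) / 2)\<bar> \<le> (u - l) / 2"
  proof (rule list_mean_diff_le[OF assms(1)])
    fix x assume "x \<in> set xs"
    then have "l \<le> f x" "f x \<le> u" using assms(2) by auto
    then show "\<bar>f x - (l + u) / 2\<bar> \<le> (u - l) / 2" by (simp add: abs_le_iff field_simps)
  qed
  then have "\<bar>list_mean xs f - (l + u) / 2\<bar> \<le> (u - l) / 2"
    by (simp only: list_mean_const[OF assms(1)])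
  then have "list_mean xs f - (l + u) / 2 \<le> (u - l) / 2" "(l + u) / 2 - list_mean xs f \<le> (u - l) / 2"
    by linarith+
  then show ?thesis by (simp add: field_simps)
qed

lemma list_mean_in_convex:
  assumes "t \<noteq> []" and "convex K" and "set t \<subseteq> K"
  shows "(\<lambda>x. list_mean t (\<lambda>f. f x)) \<in> K"
  using assms(1,3)
proof (induction t rule: list_nonempty_induct)
  case (single f)
  then show ?case by (simp add: list_mean_def)
next
  case (cons f t)
  let ?n = "real (length t)"
  have "(1 / (?n + 1)) *\<^sub>R f + (?n / (?n + 1)) *\<^sub>R (\<lambda>x. list_mean t (\<lambda>f. f x)) \<in> K"
    using cons by (intro convexD[OF assms(2)]) (auto simp: field_simps)
  moreover have "(1 / (?n + 1)) *\<^sub>R f + (?n / (?n + 1)) *\<^sub>R (\<lambda>x. list_mean t (\<lambda>f. f x))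
      = (\<lambda>x. list_mean (f # t) (\<lambda>f. f x))"
    using cons(1) by (auto simp: fun_eq_iff scaleR_fun_def list_mean_def add_divide_distrib add.commute)
  ultimately show ?case by simp
qed

text \<open>Repetitions in \<open>xs\<close> act as weights. The bound \<open>\<epsilon>\<close> may be \<open>0\<close>, which is the case of a section.\<close>
definition approximating_list ::
  "'a set \<Rightarrow> 'b set \<Rightarrow> ('a \<Rightarrow> 'b \<Rightarrow> real) \<Rightarrow> real \<Rightarrow> ('b \<Rightarrow> real) \<Rightarrow> 'a list \<Rightarrow> bool" where
  "approximating_list A B \<phi> \<epsilon> p xs \<longleftrightarrow>
    xs \<noteq> [] \<and> set xs \<subseteq> A \<and> (\<forall>b\<in>B. \<bar>p b - list_mean xs (\<lambda>a. \<phi> a b)\<bar> \<le> \<epsilon>)"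

lemma mean_definable_iff_list:
  "mean_definable A B \<phi> p \<longleftrightarrow>
    (\<forall>\<epsilon>>0. \<exists>xs. approximating_list A B \<phi> \<epsilon> p xs)"
proof -
  have "(\<exists>n a. n > 0 \<and> (\<forall>i<n. a i \<in> A) \<and>
       (\<forall>b\<in>B. \<bar>p b - (1 / real n) * (\<Sum>i<n. \<phi> (a i) b)\<bar> \<le> \<epsilon>)) \<longleftrightarrow>
     (\<exists>xs. approximating_list A B \<phi> \<epsilon> p xs)"
    (is "?L \<longleftrightarrow> ?R") for \<epsilon>
  proof
    assume ?L
    then obtain n a where *: "n > 0" "\<forall>i<n. a i \<in> A"
       "\<forall>b\<in>B. \<bar>p b - (1 / real n) * (\<Sum>i<n. \<phi> (a i) b)\<bar> \<le> \<epsilon>" by blast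
    have "(\<Sum>x\<leftarrow>map a [0..<n]. \<phi> x b) = (\<Sum>i<n. \<phi> (a i) b)" for b
      by (simp add: o_def interv_sum_list_conv_sum_set_nat atLeast0LessThan)
    then show ?R using * by (intro exI[of _ "map a [0..<n]"])
        (auto simp: approximating_list_def list_mean_def)
  next
    assume ?R
    then obtain xs where *: "xs \<noteq> []" "set xs \<subseteq> A"
      "\<forall>b\<in>B. \<bar>p b - list_mean xs (\<lambda>a. \<phi> a b)\<bar> \<le> \<epsilon>"
      unfolding approximating_list_def by blast
    have "(\<Sum>x\<leftarrow>xs. \<phi> x b) = (\<Sum>i<length xs. \<phi> (xs ! i) b)" for b
      by (simp add: sum_list_sum_nth atLeast0LessThan)
    then show ?L using * by (intro exI[of _ "length xs"] exI[of _ "(!) xs"]) (auto simp: list_mean_def)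
  qed
  then show ?thesis unfolding mean_definable_def by simp
qed

lemma sum_list_concat_replicate:
  "(\<Sum>x\<leftarrow>concat (replicate n xs). f x) = real n * (\<Sum>x\<leftarrow>xs. f x)"
  by (induction n) (auto simp: algebra_simps)

lemma length_concat_replicate: "length (concat (replicate n xs)) = n * length xs"
  by (induction n) auto

text \<open>Uniform limits of averages absorb arbitrary real weights, since these can be approximated by
  rational ones. In this way convex hulls and averages become interchangeable.\<close>
lemma convex_mean_definable:
  assumes bound: "\<And>a b. a \<in> A \<Longrightarrow> b \<in> B \<Longrightarrow> \<bar>\<phi> a b\<bar> \<le> M"
  shows "convex {p. mean_definable A B \<phi> p}"
proof (rule convexI, clarify)
  fix p q and s t :: real
  assume p: "mean_definable A B \<phi> p" and q: "mean_definable A B \<phi> q"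
    and st: "0 \<le> s" "0 \<le> t" "s + t = 1"
  show "mean_definable A B \<phi> (s *\<^sub>R p + t *\<^sub>R q)"
    unfolding mean_definable_iff_list
  proof (intro allI impI)
    fix \<epsilon> :: real assume "\<epsilon> > 0"
    obtain xs where xs: "xs \<noteq> []" "set xs \<subseteq> A"
      "\<And>b. b\<in>B \<Longrightarrow> \<bar>p b - list_mean xs (\<lambda>a. \<phi> a b)\<bar> \<le> \<epsilon> / 2"
      using p \<open>\<epsilon> > 0\<close> unfolding mean_definable_iff_list approximating_list_def
      by (meson half_gt_zero)
    obtain ys where ys: "ys \<noteq> []" "set ys \<subseteq> A"
      "\<And>b. b\<in>B \<Longrightarrow> \<bar>q b - list_mean ys (\<lambda>a. \<phi> a b)\<bar> \<le> \<epsilon> / 2"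
      using q \<open>\<epsilon> > 0\<close> unfolding mean_definable_iff_list approximating_list_def
      by (meson half_gt_zero)
    obtain N :: nat where N: "real N * \<epsilon> > 4 * \<bar>M\<bar>" "N > 0"
    proof -
      obtain N :: nat where "4 * \<bar>M\<bar> < real N * \<epsilon>" using \<open>\<epsilon> > 0\<close> reals_Archimedean3 by blast
      moreover from this have "N > 0" using \<open>\<epsilon> > 0\<close> by (intro gr0I) auto
      ultimately show thesis using that by blast
    qed
    \<comment> \<open>The weight s is replaced by a fraction k / N. The list zs repeats xs and ys so often that
      all entries together carry the weights k / N and 1 - k / N.\<close>
    define k where "k = nat \<lfloor>s * N\<rfloor>"
    have k: "real k \<le> s * N" "s * N < real k + 1"
      using st unfolding k_def by (auto simp: of_nat_nat)
    have "s * N \<le> N" using st by (simp add: mult_left_le_one_le)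
    with k(1) have "k \<le> N" by (metis of_nat_le_iff order_trans)
    define zs where "zs = concat (replicate (k * length ys) xs) @ concat (replicate ((N - k) * length xs) ys)"
    have len: "length zs = N * length xs * length ys"
    proof -
      have "length zs = (k + (N - k)) * (length xs * length ys)"
        unfolding zs_def length_append length_concat_replicate add_mult_distrib by simp
      then show ?thesis using \<open>k \<le> N\<close> by simp
    qed
    have avg: "list_mean zs (\<lambda>a. \<phi> a b) =
        (k / N) * (list_mean xs (\<lambda>a. \<phi> a b)) + (1 - k / N) * (list_mean ys (\<lambda>a. \<phi> a b))" for b
      using xs(1) ys(1) N(2) \<open>k \<le> N\<close>
      unfolding list_mean_def len
      by (simp add: zs_def sum_list_concat_replicate of_nat_diff field_simps)
    have small: "\<bar>(s *\<^sub>R p + t *\<^sub>R q) b - list_mean zs (\<lambda>a. \<phi> a b)\<bar> \<le> \<epsilon>" if "b \<in> B" for b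
    proof -
      define X where "X = list_mean xs (\<lambda>a. \<phi> a b)"
      define Y where "Y = list_mean ys (\<lambda>a. \<phi> a b)"
      have mean_le: "\<bar>list_mean us (\<lambda>a. \<phi> a b)\<bar> \<le> \<bar>M\<bar>" if "us \<noteq> []" "set us \<subseteq> A" for us
      proof -
        have "\<bar>\<phi> a b - 0\<bar> \<le> \<bar>M\<bar>" if "a \<in> set us" for a
          using bound[of a b] that \<open>set us \<subseteq> A\<close> \<open>b \<in> B\<close> by fastforce
        from list_mean_diff_le[OF \<open>us \<noteq> []\<close> this] show ?thesis
          by (simp add: list_mean_def)
      qed
      have X: "\<bar>X\<bar> \<le> \<bar>M\<bar>" and Y: "\<bar>Y\<bar> \<le> \<bar>M\<bar>" unfolding X_def Y_def using mean_le xs ys by auto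
      have pX: "\<bar>p b - X\<bar> \<le> \<epsilon> / 2" and qY: "\<bar>q b - Y\<bar> \<le> \<epsilon> / 2"
        using xs(3) ys(3) that by (auto simp: X_def Y_def)
      have "\<bar>s * N - k\<bar> / N \<le> 1 / N" using k by (intro divide_right_mono) auto
      moreover have "s - k / N = (s * N - k) / N" using N(2) by (simp add: field_simps)
      ultimately have "\<bar>s - k / N\<bar> \<le> 1 / N" by (simp add: abs_divide)
      then have "\<bar>s - k / N\<bar> * \<bar>X - Y\<bar> \<le> (1 / N) * (2 * \<bar>M\<bar>)"
        using X Y by (intro mult_mono) auto
      also have "\<dots> \<le> \<epsilon> / 2" using N by (simp add: field_simps)
      finally have 1: "\<bar>(s - k / N) * (X - Y)\<bar> \<le> \<epsilon> / 2" by (simp add: abs_mult)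
      have "\<bar>s * (p b - X) + t * (q b - Y)\<bar> \<le> \<epsilon> / 2"
        using pX qY st by (rule abs_convex_combination_le)
      moreover have "(s *\<^sub>R p + t *\<^sub>R q) b - ((k / N) * X + (1 - k / N) * Y)
          = s * (p b - X) + t * (q b - Y) + (s - k / N) * (X - Y)"
      proof -
        have t: "t = 1 - s" using st(3) by simp
        show ?thesis by (simp add: scaleR_fun_def t algebra_simps diff_divide_distrib)
      qed
      ultimately show ?thesis
        using 1 unfolding avg X_def[symmetric] Y_def[symmetric] by linarith
    qed
    have "zs \<noteq> []" using len N(2) xs(1) ys(1) by auto
    moreover have "set zs \<subseteq> A" using xs(2) ys(2) by (auto simp: zs_def)
    ultimately show "\<exists>xs. approximating_list A B \<phi> \<epsilon> (s *\<^sub>R p + t *\<^sub>R q) xs"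
      unfolding approximating_list_def using small by blast
  qed
qed

section \<open>From the pointwise to the uniform closure\<close>

text \<open>The passage from the pointwise to the uniform closure. If \<open>p\<close> is not uniformly approximable, every
  \<open>f\<close> in the hull has a point \<open>\<beta> f\<close> where it differs from \<open>p\<close> by more than \<open>\<epsilon>\<close>. A closing-off argument
  produces a sequence in the hull that converges to \<open>p\<close> at the witnesses of all averages of its own
  members. By Krein's theorem the hull still has the double limit property, so by Mazur's lemma some
  such average is within \<open>\<epsilon>\<close> of \<open>p\<close> at all these witnesses, in particular at its own.\<close>
proposition pointwise_closure_convex_hull_uniformly_approximable:
  fixes \<Phi> :: "('b \<Rightarrow> real) set"
  assumes dlp: "double_limit_property \<Phi> B (\<lambda>f. f)"
    and bound: "\<And>f b. f \<in> \<Phi> \<Longrightarrow> b \<in> B \<Longrightarrow> \<bar>f b\<bar> \<le> M"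
    and p: "\<And>D \<epsilon>. finite D \<Longrightarrow> D \<subseteq> B \<Longrightarrow> \<epsilon> > 0 \<Longrightarrow> \<exists>f\<in>convex hull \<Phi>. \<forall>b\<in>D. \<bar>f b - p b\<bar> < \<epsilon>"
    and "\<epsilon> > 0"
  shows "\<exists>f\<in>convex hull \<Phi>. \<forall>b\<in>B. \<bar>f b - p b\<bar> \<le> \<epsilon>"
proof (rule ccontr)
  define K where "K = convex hull \<Phi>"
  assume "\<not> ?thesis"
  then have "\<forall>f\<in>K. \<exists>b\<in>B. \<epsilon> < \<bar>f b - p b\<bar>" by (force simp: K_def)
  then obtain \<beta> where \<beta>: "\<And>f. f \<in> K \<Longrightarrow> \<beta> f \<in> B" "\<And>f. f \<in> K \<Longrightarrow> \<epsilon> < \<bar>f (\<beta> f) - p (\<beta> f)\<bar>"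
    by metis
  define avg where "avg t = (\<lambda>b. list_mean t (\<lambda>f. f b))" for t :: "('b \<Rightarrow> real) list"
  have avgK: "avg t \<in> K" if "t \<noteq> []" "set t \<subseteq> K" for t
    unfolding avg_def using that list_mean_in_convex[of t K] by (simp add: K_def)
  \<comment> \<open>Each f n approximates p on the points that witness the failure of all averages, of bounded
    length, of the functions chosen before. Averages rather than arbitrary convex combinations keep
    these sets of points finite.\<close>
  define D where "D n F = (\<beta> \<circ> avg) ` {t. set t \<subseteq> F \<and> length t \<le> n \<and> t \<noteq> []}"
    for n :: nat and F :: "('b \<Rightarrow> real) set"
  have "\<exists>F. \<forall>n. (finite (F n) \<and> F n \<subseteq> K) \<and>
     (\<exists>f\<in>K. F (Suc n) = insert f (F n) \<and> (\<forall>b\<in>D n (F n). \<bar>f b - p b\<bar> < 1 / Suc n))"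
  proof (rule dependent_nat_choice)
    show "\<exists>F. finite F \<and> F \<subseteq> K" by blast
  next
    fix F and n :: nat
    assume F: "finite F \<and> F \<subseteq> K"
    have "finite {t. set t \<subseteq> F \<and> length t \<le> n \<and> t \<noteq> []}"
      by (rule finite_subset[OF _ finite_lists_length_le[of F n]]) (use F in auto)
    then have "finite (D n F)" by (simp add: D_def)
    moreover have "D n F \<subseteq> B" using F avgK \<beta>(1) by (auto simp: D_def)
    ultimately obtain f where "f \<in> K" "\<forall>b\<in>D n F. \<bar>f b - p b\<bar> < 1 / Suc n"
      using p[of "D n F" "1 / Suc n"] by (auto simp: K_def)
    then show "\<exists>F'. (finite F' \<and> F' \<subseteq> K) \<and>
       (\<exists>f\<in>K. F' = insert f F \<and> (\<forall>b\<in>D n F. \<bar>f b - p b\<bar> < 1 / Suc n))"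
      using F by (intro exI[of _ "insert f F"]) auto
  qed
  then obtain F where F: "\<And>n. F n \<subseteq> K"
    "\<And>n. \<exists>f\<in>K. F (Suc n) = insert f (F n) \<and> (\<forall>b\<in>D n (F n). \<bar>f b - p b\<bar> < 1 / Suc n)"
    by metis
  then obtain f where f: "\<And>n. f n \<in> K" "\<And>n. F (Suc n) = insert (f n) (F n)"
    "\<And>n b. b \<in> D n (F n) \<Longrightarrow> \<bar>f n b - p b\<bar> < 1 / Suc n"
    by metis
  have f_in_F: "f m \<in> F n" if "m < n" for m n
    using that by (induction n) (auto simp: f(2) less_Suc_eq)
  define C where "C = (\<beta> \<circ> avg) ` {t. t \<noteq> [] \<and> set t \<subseteq> range f}"
  have CB: "C \<subseteq> B"
  proof
    fix b assume "b \<in> C"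
    then obtain t where "b = \<beta> (avg t)" "t \<noteq> []" "set t \<subseteq> range f" by (auto simp: C_def)
    moreover from this have "avg t \<in> K" using avgK[of t] f(1) by blast
    ultimately show "b \<in> B" using \<beta>(1) by simp
  qed
  have lim: "(\<lambda>n. f n b) \<longlonglongrightarrow> p b" if b: "b \<in> C" for b
  proof -
    obtain t where t: "t \<noteq> []" "set t \<subseteq> range f" "b = \<beta> (avg t)" using b by (auto simp: C_def)
    obtain I where I: "finite I" "set t = f ` I"
      using finite_subset_image[OF finite_set t(2)] by blast
    then obtain k where "I \<subseteq> {..<k}" using finite_nat_iff_bounded by blast
    then have k: "\<exists>m<k. x = f m" if "x \<in> set t" for x using that I(2) by blast
    have close: "\<bar>f n b - p b\<bar> < 1 / Suc n" if "n \<ge> max k (length t)" for n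
    proof (rule f(3))
      have "set t \<subseteq> F n" using k f_in_F that by fastforce
      then show "b \<in> D n (F n)" using t that by (auto simp: D_def)
    qed
    have "(\<lambda>n. f n b - p b) \<longlonglongrightarrow> 0"
    proof (rule Lim_null_comparison)
      show "\<forall>\<^sub>F n in sequentially. norm (f n b - p b) \<le> 1 / Suc n"
        unfolding eventually_sequentially using close less_imp_le by (metis real_norm_def)
      show "(\<lambda>n. 1 / Suc n) \<longlonglongrightarrow> 0"
        using LIMSEQ_inverse_real_of_nat by (simp add: inverse_eq_divide)
    qed
    then show ?thesis by (simp add: LIM_zero_iff)
  qed
  have boundK: "\<bar>h b\<bar> \<le> M" if "h \<in> K" "b \<in> B" for h b
    using convex_hull_bounded[of h \<Phi> b "- M" M] that bound
    by (fastforce simp: K_def abs_le_iff minus_le_iff)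
  have "double_limit_property K B (\<lambda>f. f)"
    unfolding K_def using dlp bound by (rule double_limit_property_convex_hull)
  then have "double_limit_property UNIV C f"
    by (rule double_limit_property_reindex[where f = f and g = "\<lambda>b. b"]) (use f(1) CB in auto)
  then obtain g where g: "g \<in> convex hull (range f)" "\<And>b. b \<in> C \<Longrightarrow> \<bar>g b - p b\<bar> \<le> \<epsilon> / 2"
    using pointwise_limit_uniformly_approximable[of C f M p "\<epsilon> / 2"] boundK[OF f(1)] CB lim \<open>\<epsilon> > 0\<close>
    by (metis half_gt_zero subsetD)
  have bound_f: "\<bar>h b\<bar> \<le> M" if "h \<in> range f" "b \<in> C" for h b
    using boundK f(1) CB that by blast
  have "mean_definable (range f) C (\<lambda>f. f) h" if "h \<in> range f" for h
    unfolding mean_definable_iff_list approximating_list_def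
    by (intro allI impI exI[of _ "[h]"]) (use that in \<open>auto simp: list_mean_def\<close>)
  moreover have "convex {h. mean_definable (range f) C (\<lambda>f. f) h}"
    using bound_f by (rule convex_mean_definable)
  ultimately have "convex hull (range f) \<subseteq> {h. mean_definable (range f) C (\<lambda>f. f) h}"
    by (intro hull_minimal) auto
  with g(1) have "mean_definable (range f) C (\<lambda>f. f) g" by blast
  moreover have "\<epsilon> / 2 > 0" using \<open>\<epsilon> > 0\<close> by simp
  ultimately obtain t where t: "approximating_list (range f) C (\<lambda>f. f) (\<epsilon> / 2) g t"
    unfolding mean_definable_iff_list by blast
  define b where "b = \<beta> (avg t)"
  have "b \<in> C" "avg t \<in> K"
    using t f(1) by (auto simp: C_def b_def approximating_list_def intro!: avgK)
  then have "\<bar>g b - avg t b\<bar> \<le> \<epsilon> / 2" "\<bar>g b - p b\<bar> \<le> \<epsilon> / 2" "\<epsilon> < \<bar>avg t b - p b\<bar>"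
    using t g(2) \<beta>(2) by (auto simp: b_def avg_def approximating_list_def)
  then show False by linarith
qed

section \<open>Sections in the topology of pointwise convergence\<close>

lemma continuous_image_in_closure:
  assumes "continuous_map (subtopology X T) euclideanreal g"
    and "p \<in> X closure_of S" and "p \<in> T" and "S \<subseteq> T"
  shows "g p \<in> closure (g ` S)"
proof -
  have "p \<in> subtopology X T closure_of S"
    using assms(2-4) by (simp add: closure_of_subtopology Int_absorb1)
  then show ?thesis
    using continuous_map_image_closure_subset[OF assms(1), of S] by auto
qed

lemma continuous_maps_agree_on_closure:
  fixes f g :: "'x \<Rightarrow> real"
  assumes "continuous_map (subtopology X T) euclideanreal f"
    and "continuous_map (subtopology X T) euclideanreal g"
    and "p \<in> X closure_of S" and "p \<in> T" and "S \<subseteq> T" and "\<And>x. x \<in> S \<Longrightarrow> f x = g x"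
  shows "f p = g p"
proof (rule forall_in_closure_of_eq[OF _ _ assms(1,2,6)])
  show "p \<in> subtopology X T closure_of S"
    using assms(3-5) by (simp add: closure_of_subtopology Int_absorb1)
qed auto

lemma continuous_map_evaluation:
  "b \<in> B \<Longrightarrow> continuous_map (subtopology (powertop_real B) T) euclideanreal (\<lambda>f. f b)"
  by (intro continuous_map_from_subtopology continuous_map_product_projection)

text \<open>A single continuous function, the sum of the distances over \<open>D\<close>, describes the basic
  neighbourhoods of \<open>p\<close>.\<close>
lemma pointwise_closure_approximation:
  assumes "p \<in> powertop_real B closure_of S" and "finite D" and "D \<subseteq> B" and "\<epsilon> > 0"
  shows "\<exists>f\<in>S. \<forall>b\<in>D. \<bar>f b - p b\<bar> < \<epsilon>"
proof -
  define g where "g f = (\<Sum>b\<in>D. \<bar>f b - p b\<bar>)" for f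
  have "continuous_map (subtopology (powertop_real B) UNIV) euclideanreal g"
    unfolding g_def using assms(2,3)
    by (intro continuous_map_sum continuous_map_real_abs continuous_map_diff continuous_map_evaluation) auto
  then have "g p \<in> closure (g ` S)"
    using assms(1) by (rule continuous_image_in_closure) auto
  then obtain f where f: "f \<in> S" "dist (g f) (g p) < \<epsilon>"
    using \<open>\<epsilon> > 0\<close> by (auto simp: closure_approachable)
  then have "g f < \<epsilon>" by (simp add: g_def dist_real_def)
  moreover have "\<bar>f b - p b\<bar> \<le> g f" if "b \<in> D" for b
    unfolding g_def using assms(2) that by (intro member_le_sum) auto
  ultimately show ?thesis using f(1) by force
qed

lemma sections_in_cl_sections: "sections A B \<phi> \<subseteq> cl_sections A B \<phi>"
  unfolding cl_sections_def by (rule closure_of_subset) (auto simp: sections_def section_at_def)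

lemma section_at_in_cl_sections: "a \<in> A \<Longrightarrow> section_at B \<phi> a \<in> cl_sections A B \<phi>"
  using sections_in_cl_sections[of A B \<phi>] by (auto simp: sections_def)

lemma cl_sections_subset_cl_co_sections: "cl_sections A B \<phi> \<subseteq> cl_co_sections A B \<phi>"
  unfolding cl_sections_def cl_co_sections_def by (intro closure_of_mono hull_subset)

text \<open>The point to check is that hulls stay inside \<open>extensional B\<close>: outside \<open>B\<close> a combination with weights
  of sum one takes the value \<open>undefined\<close> again.\<close>
lemma convex_hull_sections_subset_cl_co_sections:
  fixes A :: "'a set" and B :: "'b set"
  shows
  "convex hull sections A B \<phi> \<subseteq> cl_co_sections A B \<phi>"
  unfolding cl_co_sections_def
proof (rule closure_of_subset)
  have "convex (extensional B :: ('b \<Rightarrow> real) set)"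
  proof (rule convexI)
    fix f g :: "'b \<Rightarrow> real" and s t :: real
    assume *: "f \<in> extensional B" "g \<in> extensional B" "s + t = 1"
    show "s *\<^sub>R f + t *\<^sub>R g \<in> extensional B"
      unfolding extensional_def
    proof (clarify)
      fix x assume "x \<notin> B"
      then have "(s *\<^sub>R f + t *\<^sub>R g) x = (s + t) * undefined"
        using *(1,2) unfolding distrib_right by (simp add: extensional_def scaleR_fun_def)
      then show "(s *\<^sub>R f + t *\<^sub>R g) x = undefined" unfolding *(3) by simp
    qed
  qed
  then have "convex hull sections A B \<phi> \<subseteq> extensional B"
    by (intro hull_minimal) (auto simp: sections_def section_at_def)
  then show "convex hull sections A B \<phi> \<subseteq> topspace (powertop_real B)"
    by (simp add: PiE_UNIV_domain PiE_def)
qed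

lemma sections_bounded:
  assumes "\<phi> \<in> A \<rightarrow> B \<rightarrow> {l..u}" and "f \<in> sections A B \<phi>" and "b \<in> B"
  shows "f b \<in> {l..u}"
proof -
  obtain a where "a \<in> A" "f = section_at B \<phi> a" using assms(2) by (auto simp: sections_def)
  then show ?thesis using Pi_mem[OF Pi_mem[OF assms(1)] assms(3)] assms(3) by (simp add: section_at_def)
qed

lemma cl_co_sections_bounded:
  assumes "\<phi> \<in> A \<rightarrow> B \<rightarrow> {l..u}" and "p \<in> cl_co_sections A B \<phi>" and "b \<in> B"
  shows "p b \<in> {l..u}"
proof -
  have "p b \<in> closure ((\<lambda>f. f b) ` (convex hull sections A B \<phi>))"
    using assms(2,3) continuous_map_evaluation[of b B UNIV]
    by (intro continuous_image_in_closure[of "powertop_real B" UNIV]) (auto simp: cl_co_sections_def)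
  also have "\<dots> \<subseteq> {l..u}"
    using convex_hull_bounded[of _ "sections A B \<phi>" b l u] sections_bounded[OF assms(1) _ assms(3)]
    by (intro closure_minimal) auto
  finally show ?thesis .
qed

text \<open>Compactness of the cube \<open>{l..u}\<^sup>B\<close> gives a point in the closures of all tails. Subsequences may fail to
  converge pointwise when \<open>B\<close> is uncountable, so limits of continuous functions are read off
  from these closures instead.\<close>
lemma sections_cluster_point:
  assumes \<phi>: "\<phi> \<in> A \<rightarrow> B \<rightarrow> {l..u}" and a: "\<And>n::nat. a n \<in> A"
  obtains p where "p \<in> cl_sections A B \<phi>"
    "\<And>N. p \<in> powertop_real B closure_of ((\<lambda>n. section_at B \<phi> (a n)) ` {N..})"
proof -
  define X where "X = subtopology (powertop_real B) (\<Pi>\<^sub>E b\<in>B. {l..u})"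
  define S where "S N = (\<lambda>n. section_at B \<phi> (a n)) ` {N..}" for N
  have "compactin (powertop_real B) (\<Pi>\<^sub>E b\<in>B. {l..u})" by (simp add: compactin_PiE)
  then have "compact_space X" by (simp add: X_def compactin_subspace)
  moreover have S_sub: "S N \<subseteq> topspace X" for N
    using \<phi> a by (fastforce simp: S_def X_def section_at_def)
  have "X closure_of S N \<noteq> {}" for N
    using closure_of_subset[OF S_sub[of N]] by (auto simp: S_def)
  moreover have "decseq (\<lambda>N. X closure_of S N)"
    unfolding S_def by (intro decseq_SucI closure_of_mono image_mono) auto
  ultimately have "(\<Inter>N. X closure_of S N) \<noteq> {}"
    by (intro compact_space_imp_nest) auto
  then obtain p where "\<And>N. p \<in> X closure_of S N" by blast
  then have p: "p \<in> powertop_real B closure_of S N" for N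
    using closure_of_subtopology_subset unfolding X_def by (metis subsetD)
  have "S 0 \<subseteq> sections A B \<phi>" using a by (auto simp: S_def sections_def)
  then have "p \<in> cl_sections A B \<phi>"
    unfolding cl_sections_def using p[of 0] closure_of_mono by blast
  with p that show thesis by (simp add: S_def)
qed

lemma double_limit_property_sections:
  assumes "double_limit_property A B \<phi>"
  shows "double_limit_property (sections A B \<phi>) B (\<lambda>f. f)"
proof (rule double_limit_propertyI)
  fix f b x y x' y'
  assume f: "\<And>n::nat. f n \<in> sections A B \<phi>" and b: "\<And>m::nat. b m \<in> B"
    and *: "\<And>n. (\<lambda>m. f n (b m)) \<longlonglongrightarrow> x n" "x \<longlonglongrightarrow> x'" "\<And>m. (\<lambda>n. f n (b m)) \<longlonglongrightarrow> y m" "y \<longlonglongrightarrow> y'"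
  have "\<forall>n. \<exists>a\<in>A. f n = section_at B \<phi> a" using f by (auto simp: sections_def)
  then obtain a where a: "\<And>n. a n \<in> A" "\<And>n. f n = section_at B \<phi> (a n)" by metis
  then have "f n (b m) = \<phi> (a n) (b m)" for n m using b by (simp add: section_at_def)
  with * show "x' = y'"
    by (intro double_limit_propertyD[OF assms, of a b x x' y y'] a(1) b) simp_all
qed

section \<open>Separately continuous extensions and iterated limits\<close>

lemma limit_eq_if_in_closure_of_tails:
  fixes s :: "nat \<Rightarrow> real"
  assumes "\<And>N. z \<in> closure (s ` {N..})" and "s \<longlonglongrightarrow> L"
  shows "z = L"
proof (rule ccontr)
  assume "z \<noteq> L"
  then obtain N where N: "\<And>n. n \<ge> N \<Longrightarrow> dist (s n) L < dist z L / 2"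
    using metric_LIMSEQ_D[OF assms(2), of "dist z L / 2"] by auto
  have "closure (s ` {N..}) \<subseteq> cball L (dist z L / 2)"
    using less_imp_le[OF N] by (intro closure_minimal) (auto simp: dist_commute)
  then have "dist L z \<le> dist z L / 2" using assms(1)[of N] by auto
  then show False using \<open>z \<noteq> L\<close> by (simp add: dist_commute)
qed

lemma continuous_extension_op:
  "continuous_extension I A B \<phi> F \<Longrightarrow> continuous_extension I B A (op_fun \<phi>) (\<lambda>q p. F p q)"
  unfolding continuous_extension_def extends_sections_def separately_continuous_on_def
  by (auto simp: op_fun_apply)

lemma continuous_extension_continuous:
  assumes "continuous_extension I A B \<phi> F"
  shows "p \<in> cl_sections A B \<phi> \<Longrightarrow>
      continuous_map (subtopology (powertop_real A) (cl_sections B A (op_fun \<phi>))) euclideanreal (F p)"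
    and "q \<in> cl_sections B A (op_fun \<phi>) \<Longrightarrow>
      continuous_map (subtopology (powertop_real B) (cl_sections A B \<phi>)) euclideanreal (\<lambda>p. F p q)"
  using assms unfolding continuous_extension_def separately_continuous_on_def by blast+

text \<open>Both sides are continuous in \<open>p\<close> and agree on the dense set of sections. Hence the values of an
  extension are determined in each variable in turn.\<close>
lemma continuous_extension_eval:
  assumes F: "continuous_extension I A B \<phi> F" and p: "p \<in> cl_sections A B \<phi>" and b: "b \<in> B"
  shows "F p (section_at A (op_fun \<phi>) b) = p b"
proof -
  have agree: "F f (section_at A (op_fun \<phi>) b) = f b" if f: "f \<in> sections A B \<phi>" for f
  proof -
    obtain a where a: "a \<in> A" "f = section_at B \<phi> a" using f by (auto simp: sections_def)
    then have "F f (section_at A (op_fun \<phi>) b) = \<phi> a b"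
      using F b unfolding continuous_extension_def extends_sections_def by blast
    then show ?thesis using a b by (simp add: section_at_def)
  qed
  have "p \<in> powertop_real B closure_of sections A B \<phi>"
    using p by (simp add: cl_sections_def)
  from continuous_maps_agree_on_closure[OF
      continuous_extension_continuous(2)[OF F section_at_in_cl_sections[OF b]]
      continuous_map_evaluation[OF b] this p sections_in_cl_sections agree]
  show ?thesis .
qed

lemma continuous_extension_unique:
  assumes F: "continuous_extension I A B \<phi> F" and G: "continuous_extension I A B \<phi> G"
    and p: "p \<in> cl_sections A B \<phi>" and q: "q \<in> cl_sections B A (op_fun \<phi>)"
  shows "F p q = G p q"
proof -
  have agree: "F p g = G p g" if g: "g \<in> sections B A (op_fun \<phi>)" for g
  proof -
    obtain b where "b \<in> B" "g = section_at A (op_fun \<phi>) b" using g by (auto simp: sections_def)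
    then show ?thesis
      using continuous_extension_eval[OF F p, of b] continuous_extension_eval[OF G p, of b] by simp
  qed
  have "q \<in> powertop_real A closure_of sections B A (op_fun \<phi>)"
    using q by (simp add: cl_sections_def)
  from continuous_maps_agree_on_closure[OF continuous_extension_continuous(1)[OF F p]
      continuous_extension_continuous(1)[OF G p] this q sections_in_cl_sections agree]
  show ?thesis .
qed

text \<open>At cluster points an extension has the value of the iterated limit; applying this to \<open>\<phi>\<close> and to
  \<open>op_fun \<phi>\<close> gives both orders of limits for the same value \<open>F p q\<close>.\<close>
lemma continuous_extension_eq_iterated_limit:
  fixes a :: "nat \<Rightarrow> 'a" and b :: "nat \<Rightarrow> 'b"
  assumes F: "continuous_extension I A B \<phi> F" and p: "p \<in> cl_sections A B \<phi>"
    and p_cl: "\<And>N. p \<in> powertop_real B closure_of ((\<lambda>n. section_at B \<phi> (a n)) ` {N..})"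
    and q: "q \<in> cl_sections B A (op_fun \<phi>)"
    and q_cl: "\<And>N. q \<in> powertop_real A closure_of ((\<lambda>m. section_at A (op_fun \<phi>) (b m)) ` {N..})"
    and b: "\<And>m. b m \<in> B"
    and y: "\<And>m. (\<lambda>n. \<phi> (a n) (b m)) \<longlonglongrightarrow> y m" and y': "y \<longlonglongrightarrow> y'"
  shows "F p q = y'"
proof -
  have "p (b m) = y m" for m
  proof (rule limit_eq_if_in_closure_of_tails[OF _ y])
    fix N
    have "p (b m) \<in> closure ((\<lambda>f. f (b m)) ` (\<lambda>n. section_at B \<phi> (a n)) ` {N..})"
      using p_cl continuous_map_evaluation[OF b, of UNIV]
      by (intro continuous_image_in_closure[where g = "\<lambda>f. f (b m)" and X = "powertop_real B" and T = UNIV]) auto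
    then show "p (b m) \<in> closure ((\<lambda>n. \<phi> (a n) (b m)) ` {N..})"
      using b by (simp add: image_image section_at_def)
  qed
  then have Fp: "F p (section_at A (op_fun \<phi>) (b m)) = y m" for m
    using continuous_extension_eval[OF F p b] by simp
  show ?thesis
  proof (rule limit_eq_if_in_closure_of_tails[OF _ y'])
    fix N
    have "F p q \<in> closure (F p ` (\<lambda>m. section_at A (op_fun \<phi>) (b m)) ` {N..})"
    proof (rule continuous_image_in_closure[OF _ q_cl q])
      show "continuous_map (subtopology (powertop_real A) (cl_sections B A (op_fun \<phi>))) euclideanreal (F p)"
        by (rule continuous_extension_continuous(1)[OF F p])
      show "(\<lambda>m. section_at A (op_fun \<phi>) (b m)) ` {N..} \<subseteq> cl_sections B A (op_fun \<phi>)"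
        by (intro image_subsetI section_at_in_cl_sections b)
    qed
    then show "F p q \<in> closure (y ` {N..})" by (simp add: image_image Fp)
  qed
qed

proposition continuous_extension_imp_double_limit_property:
  assumes \<phi>: "\<phi> \<in> A \<rightarrow> B \<rightarrow> {l..u}" and F: "continuous_extension I A B \<phi> F"
  shows "double_limit_property A B \<phi>"
proof (rule double_limit_propertyI)
  fix a b x y x' y'
  assume *: "\<And>n::nat. a n \<in> A" "\<And>m::nat. b m \<in> B" "\<And>n. (\<lambda>m. \<phi> (a n) (b m)) \<longlonglongrightarrow> x n" "x \<longlonglongrightarrow> x'"
    "\<And>m. (\<lambda>n. \<phi> (a n) (b m)) \<longlonglongrightarrow> y m" "y \<longlonglongrightarrow> y'"
  obtain p where p: "p \<in> cl_sections A B \<phi>"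
    "\<And>N. p \<in> powertop_real B closure_of ((\<lambda>n. section_at B \<phi> (a n)) ` {N..})"
    using sections_cluster_point[of \<phi> A B l u a, OF \<phi> *(1)] by metis
  obtain q where q: "q \<in> cl_sections B A (op_fun \<phi>)"
    "\<And>N. q \<in> powertop_real A closure_of ((\<lambda>m. section_at A (op_fun \<phi>) (b m)) ` {N..})"
    using sections_cluster_point[of "op_fun \<phi>" B A l u b, OF op_fun_in_PiI[OF \<phi>] *(2)] by metis
  have "F p q = y'"
    by (rule continuous_extension_eq_iterated_limit[where a = a and b = b and y = y, OF F p q *(2,5,6)])
  moreover have "F p q = x'"
    by (rule continuous_extension_eq_iterated_limit[where a = b and b = a and y = x and \<phi> = "op_fun \<phi>",
          OF continuous_extension_op[OF F] q, unfolded op_fun_op_fun op_fun_apply, OF p *(1,3,4)])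
  ultimately show "x' = y'" by simp
qed

section \<open>Separately affine extensions\<close>

lemma continuous_affine_extension_imp_continuous_extension:
  assumes "continuous_affine_extension I A B \<phi> F"
  shows "continuous_extension I A B \<phi> F"
proof -
  note sub = cl_sections_subset_cl_co_sections[of A B \<phi>] cl_sections_subset_cl_co_sections[of B A "op_fun \<phi>"]
  have "separately_continuous_on (powertop_real B) (powertop_real A)
      (cl_sections A B \<phi>) (cl_sections B A (op_fun \<phi>)) F"
    using assms sub unfolding continuous_affine_extension_def separately_continuous_on_def
    by (meson continuous_map_from_subtopology_mono subsetD)
  then show ?thesis
    using assms sub unfolding continuous_affine_extension_def continuous_extension_def
    by (auto simp: Pi_iff subset_iff)
qed

text \<open>Agreement spreads from sections to their convex hull by affinity and then to the closure by
  continuity.\<close>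
lemma affine_maps_agree_on_cl_co_sections:
  assumes f: "continuous_map (subtopology (powertop_real B) (cl_co_sections A B \<phi>)) euclideanreal f"
      "affine_map_on (cl_co_sections A B \<phi>) f"
    and g: "continuous_map (subtopology (powertop_real B) (cl_co_sections A B \<phi>)) euclideanreal g"
      "affine_map_on (cl_co_sections A B \<phi>) g"
    and fg: "\<And>a. a \<in> A \<Longrightarrow> f (section_at B \<phi> a) = g (section_at B \<phi> a)"
    and p: "p \<in> cl_co_sections A B \<phi>"
  shows "f p = g p"
proof -
  let ?H = "convex hull sections A B \<phi>"
  note sub = convex_hull_sections_subset_cl_co_sections[of A B \<phi>]
  have "convex {x \<in> ?H. f x = g x}"
  proof (rule convexI, clarify, rule conjI)
    fix x y and s t :: real
    assume *: "0 \<le> s" "0 \<le> t" "s + t = 1" "x \<in> ?H" "y \<in> ?H" "f x = g x" "f y = g y"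
    then show "s *\<^sub>R x + t *\<^sub>R y \<in> ?H" by (intro convexD[OF convex_convex_hull])
    have s: "s = 1 - t" and t: "t \<in> {0..1}" using * by auto
    have "x \<in> cl_co_sections A B \<phi>" "y \<in> cl_co_sections A B \<phi>" using * sub by auto
    then show "f (s *\<^sub>R x + t *\<^sub>R y) = g (s *\<^sub>R x + t *\<^sub>R y)"
      using f(2) g(2) t *(6,7) unfolding s affine_map_on_def by simp
  qed
  then have "?H \<subseteq> {x \<in> ?H. f x = g x}"
    by (intro hull_minimal) (auto simp: sections_def fg intro: hull_inc)
  then have agree: "f x = g x" if "x \<in> ?H" for x using that by blast
  have "p \<in> powertop_real B closure_of ?H" using p by (simp add: cl_co_sections_def)
  from continuous_maps_agree_on_closure[OF f(1) g(1) this p sub agree] show ?thesis .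
qed

lemma continuous_affine_extension_slices:
  assumes "continuous_affine_extension I A B \<phi> F"
  shows "p \<in> cl_co_sections A B \<phi> \<Longrightarrow> continuous_map
      (subtopology (powertop_real A) (cl_co_sections B A (op_fun \<phi>))) euclideanreal (F p)"
    and "p \<in> cl_co_sections A B \<phi> \<Longrightarrow> affine_map_on (cl_co_sections B A (op_fun \<phi>)) (F p)"
    and "q \<in> cl_co_sections B A (op_fun \<phi>) \<Longrightarrow> continuous_map
      (subtopology (powertop_real B) (cl_co_sections A B \<phi>)) euclideanreal (\<lambda>p. F p q)"
    and "q \<in> cl_co_sections B A (op_fun \<phi>) \<Longrightarrow> affine_map_on (cl_co_sections A B \<phi>) (\<lambda>p. F p q)"
  using assms unfolding continuous_affine_extension_def separately_continuous_on_def
    separately_affine_on_def by blast+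

lemma continuous_affine_extension_unique:
  assumes F: "continuous_affine_extension I A B \<phi> F" and G: "continuous_affine_extension I A B \<phi> G"
    and p: "p \<in> cl_co_sections A B \<phi>" and q: "q \<in> cl_co_sections B A (op_fun \<phi>)"
  shows "F p q = G p q"
proof -
  have agree: "F p (section_at A (op_fun \<phi>) b) = G p (section_at A (op_fun \<phi>) b)" if b: "b \<in> B" for b
  proof -
    have b': "section_at A (op_fun \<phi>) b \<in> cl_co_sections B A (op_fun \<phi>)"
      using cl_sections_subset_cl_co_sections section_at_in_cl_sections[OF b] by (rule subsetD)
    have ab: "F (section_at B \<phi> a) (section_at A (op_fun \<phi>) b) = G (section_at B \<phi> a) (section_at A (op_fun \<phi>) b)"
      if "a \<in> A" for a
      using F G that b by (simp add: continuous_affine_extension_def extends_sections_def)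
    show ?thesis
      by (rule affine_maps_agree_on_cl_co_sections[OF continuous_affine_extension_slices(3,4)[OF F b']
            continuous_affine_extension_slices(3,4)[OF G b'] ab p])
  qed
  show ?thesis
    by (rule affine_maps_agree_on_cl_co_sections[OF continuous_affine_extension_slices(1,2)[OF F p]
          continuous_affine_extension_slices(1,2)[OF G p] agree q])
qed

section \<open>The pairing of mean-definable functions\<close>

lemma continuous_map_list_mean:
  assumes "set xs \<subseteq> A"
  shows "continuous_map (subtopology (powertop_real A) Q) euclideanreal (list_mean xs)"
proof -
  have "continuous_map (subtopology (powertop_real A) Q) euclideanreal (\<lambda>q. \<Sum>a\<leftarrow>xs. q a)"
    using assms
  proof (induction xs)
    case (Cons a xs)
    then show ?case
      by (simp add: continuous_map_add continuous_map_evaluation)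
  qed simp
  then have "continuous_map (subtopology (powertop_real A) Q) euclideanreal
      (\<lambda>q. (\<Sum>a\<leftarrow>xs. q a) * (1 / length xs))"
    by (intro continuous_map_real_mult) auto
  then show ?thesis by (simp add: list_mean_def[abs_def])
qed

text \<open>Both means are close to the double average of \<open>\<phi>\<close> over the two lists.\<close>
lemma approximating_lists_compatible:
  assumes xs: "approximating_list A B \<phi> \<epsilon> p xs" and ys: "approximating_list B A (op_fun \<phi>) \<delta> q ys"
  shows "\<bar>list_mean xs q - list_mean ys p\<bar> \<le> \<epsilon> + \<delta>"
proof -
  have "\<bar>list_mean xs q - list_mean xs (\<lambda>a. list_mean ys (\<lambda>b. \<phi> a b))\<bar> \<le> \<delta>"
    using xs ys by (intro list_mean_diff_le) (auto simp: approximating_list_def op_fun_apply)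
  moreover have "\<bar>list_mean ys p - list_mean ys (\<lambda>b. list_mean xs (\<lambda>a. \<phi> a b))\<bar> \<le> \<epsilon>"
    using xs ys by (intro list_mean_diff_le) (auto simp: approximating_list_def)
  ultimately show ?thesis
    unfolding list_mean_swap[of xs ys] by linarith
qed

text \<open>The extension is the common limit of the means of \<open>q\<close> over approximating lists of \<open>p\<close> and of the means
  of \<open>p\<close> over approximating lists of \<open>q\<close>. The intervals of radius \<open>\<epsilon>\<close> around the former means and
  of radius \<open>\<delta>\<close> around the latter meet each other, and the infimum of the right ends of the latter lies
  in all of them.\<close>
definition mean_pairing ::
  "'a set \<Rightarrow> 'b set \<Rightarrow> ('a \<Rightarrow> 'b \<Rightarrow> real) \<Rightarrow> ('b \<Rightarrow> real) \<Rightarrow> ('a \<Rightarrow> real) \<Rightarrow> real" where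
  "mean_pairing A B \<phi> p q =
    Inf {list_mean ys p + \<delta> | ys \<delta>. approximating_list B A (op_fun \<phi>) \<delta> q ys}"

lemma mean_pairing_approximation:
  assumes p: "mean_definable A B \<phi> p" and q: "mean_definable B A (op_fun \<phi>) q"
  shows "approximating_list A B \<phi> \<epsilon> p xs \<Longrightarrow> \<bar>mean_pairing A B \<phi> p q - list_mean xs q\<bar> \<le> \<epsilon>"
    and "approximating_list B A (op_fun \<phi>) \<delta> q ys \<Longrightarrow> \<bar>mean_pairing A B \<phi> p q - list_mean ys p\<bar> \<le> \<delta>"
proof -
  let ?S = "{list_mean ys p + \<delta> | ys \<delta>. approximating_list B A (op_fun \<phi>) \<delta> q ys}"
  have px: "\<exists>xs. approximating_list A B \<phi> \<eta> p xs" and qy: "\<exists>ys. approximating_list B A (op_fun \<phi>) \<eta> q ys"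
    if "\<eta> > 0" for \<eta>
    using p q that unfolding mean_definable_iff_list by auto
  have lower: "list_mean xs q - \<epsilon> \<le> z" if "approximating_list A B \<phi> \<epsilon> p xs" "z \<in> ?S" for xs \<epsilon> z
    using approximating_lists_compatible[OF that(1)] that(2) by force
  obtain x0 where x0: "approximating_list A B \<phi> 1 p x0" using px[of 1] by auto
  have "?S \<noteq> {}" using qy[of 1] by auto
  then have ge: "list_mean xs q - \<epsilon> \<le> mean_pairing A B \<phi> p q" if "approximating_list A B \<phi> \<epsilon> p xs" for xs \<epsilon>
    unfolding mean_pairing_def using lower[OF that] by (intro cInf_greatest) auto
  have "bdd_below ?S" using lower[OF x0] by (intro bdd_belowI) auto
  then have le: "mean_pairing A B \<phi> p q \<le> list_mean ys p + \<delta>"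
    if "approximating_list B A (op_fun \<phi>) \<delta> q ys" for ys \<delta>
    unfolding mean_pairing_def using that by (intro cInf_lower) auto
  show "\<bar>mean_pairing A B \<phi> p q - list_mean xs q\<bar> \<le> \<epsilon>" if xs: "approximating_list A B \<phi> \<epsilon> p xs"
  proof -
    have "mean_pairing A B \<phi> p q \<le> (list_mean xs q + \<epsilon>) + e" if "e > 0" for e
    proof -
      obtain ys where "approximating_list B A (op_fun \<phi>) (e / 2) q ys" using qy[of "e / 2"] \<open>e > 0\<close> by auto
      from le[OF this] approximating_lists_compatible[OF xs this] show ?thesis by linarith
    qed
    then have "mean_pairing A B \<phi> p q \<le> list_mean xs q + \<epsilon>" by (rule field_le_epsilon)
    with ge[OF xs] show ?thesis by linarith
  qed
  show "\<bar>mean_pairing A B \<phi> p q - list_mean ys p\<bar> \<le> \<delta>" if ys: "approximating_list B A (op_fun \<phi>) \<delta> q ys"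
  proof -
    have "list_mean ys p - \<delta> \<le> mean_pairing A B \<phi> p q + e" if "e > 0" for e
    proof -
      obtain xs where "approximating_list A B \<phi> (e / 2) p xs" using px[of "e / 2"] \<open>e > 0\<close> by auto
      from ge[OF this] approximating_lists_compatible[OF this ys] show ?thesis by linarith
    qed
    then have "list_mean ys p - \<delta> \<le> mean_pairing A B \<phi> p q" by (rule field_le_epsilon)
    with le[OF ys] show ?thesis by linarith
  qed
qed

text \<open>The error in the hypothesis does not depend on \<open>q\<close>, so \<open>G\<close> is a uniform limit of means of
  evaluations. The same lists serve all of
  \<open>Q\<close> at once.\<close>
lemma continuous_if_mean_approximated:
  assumes p: "mean_definable A B \<phi> p"
    and G: "\<And>q \<epsilon> xs. q \<in> Q \<Longrightarrow> approximating_list A B \<phi> \<epsilon> p xs \<Longrightarrow> \<bar>G q - list_mean xs q\<bar> \<le> \<epsilon>"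
  shows "continuous_map (subtopology (powertop_real A) Q) euclideanreal G"
proof -
  have "\<forall>n. \<exists>xs. approximating_list A B \<phi> (1 / Suc n) p xs"
    using p unfolding mean_definable_iff_list by auto
  then obtain xs where xs: "\<And>n. approximating_list A B \<phi> (1 / Suc n) p (xs n)" by metis
  have "continuous_map (subtopology (powertop_real A) Q) Met_TC.mtopology G"
  proof (rule Met_TC.continuous_map_uniform_limit)
    show "\<forall>\<^sub>F n in sequentially. continuous_map (subtopology (powertop_real A) Q) Met_TC.mtopology (list_mean (xs n))"
      unfolding mtopology_is_euclidean using xs
      by (intro always_eventually allI continuous_map_list_mean) (simp add: approximating_list_def)
  next
    fix \<epsilon> :: real assume "\<epsilon> > 0"
    then obtain N where N: "1 / Suc N < \<epsilon>" using nat_approx_posE by blast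
    have "dist (list_mean (xs n) q) (G q) < \<epsilon>" if "n \<ge> N" "q \<in> Q" for n q
    proof -
      have "\<bar>G q - list_mean (xs n) q\<bar> \<le> 1 / Suc n" using G[OF that(2) xs] .
      also have "\<dots> \<le> 1 / Suc N" using that(1) by (simp add: frac_le)
      finally show ?thesis using N by (simp add: dist_real_def abs_minus_commute)
    qed
    then show "\<forall>\<^sub>F n in sequentially. \<forall>q\<in>topspace (subtopology (powertop_real A) Q).
        G q \<in> UNIV \<and> dist (list_mean (xs n) q) (G q) < \<epsilon>"
      unfolding eventually_sequentially by auto
  qed simp
  then show ?thesis by simp
qed

text \<open>Means are affine in \<open>q\<close>, and so is their limit. The hypothesis on \<open>G\<close> covers all mean-definable \<open>q\<close>,
  so that it applies to convex combinations.\<close>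
lemma affine_if_mean_approximated:
  assumes p: "mean_definable A B \<phi> p"
    and G: "\<And>q \<epsilon> xs. mean_definable B A (op_fun \<phi>) q \<Longrightarrow> approximating_list A B \<phi> \<epsilon> p xs \<Longrightarrow>
      \<bar>G q - list_mean xs q\<bar> \<le> \<epsilon>"
    and bound: "\<And>a b. a \<in> A \<Longrightarrow> b \<in> B \<Longrightarrow> \<bar>\<phi> a b\<bar> \<le> M"
    and Q: "\<And>q. q \<in> Q \<Longrightarrow> mean_definable B A (op_fun \<phi>) q"
  shows "affine_map_on Q G"
  unfolding affine_map_on_def
proof (intro ballI)
  fix q q' and t :: real assume q: "q \<in> Q" "q' \<in> Q" and t: "t \<in> {0..1}"
  let ?r = "(1 - t) *\<^sub>R q + t *\<^sub>R q'"
  have "convex {q. mean_definable B A (op_fun \<phi>) q}"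
    by (rule convex_mean_definable[where M = M]) (use bound in \<open>auto simp: op_fun_apply\<close>)
  then have r: "mean_definable B A (op_fun \<phi>) ?r"
    using convexD[of "{q. mean_definable B A (op_fun \<phi>) q}" q q' "1 - t" t] Q q t by auto
  have "\<bar>G ?r - ((1 - t) * G q + t * G q')\<bar> \<le> 0 + e" if "e > 0" for e
  proof -
    obtain xs where xs: "approximating_list A B \<phi> (e / 2) p xs"
      using p \<open>e > 0\<close> unfolding mean_definable_iff_list by (meson half_gt_zero)
    have "\<bar>(1 - t) * (G q - list_mean xs q) + t * (G q' - list_mean xs q')\<bar> \<le> e / 2"
      using G[OF Q[OF q(1)] xs] G[OF Q[OF q(2)] xs] t by (intro abs_convex_combination_le) auto
    moreover have "\<bar>G ?r - list_mean xs ?r\<bar> \<le> e / 2" by (rule G[OF r xs])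
    moreover have "(1 - t) * (G q - list_mean xs q) + t * (G q' - list_mean xs q')
        = ((1 - t) * G q + t * G q') - list_mean xs ?r"
      unfolding list_mean_linear by (simp add: algebra_simps)
    ultimately show ?thesis by linarith
  qed
  then have "\<bar>G ?r - ((1 - t) * G q + t * G q')\<bar> \<le> 0" by (rule field_le_epsilon)
  then show "G ?r = (1 - t) * G q + t * G q'" by simp
qed

lemma approximating_list_section:
  "a \<in> A \<Longrightarrow> approximating_list A B \<phi> 0 (section_at B \<phi> a) [a]"
  by (auto simp: approximating_list_def list_mean_def section_at_def)

lemma mean_definable_section:
  assumes "a \<in> A"
  shows "mean_definable A B \<phi> (section_at B \<phi> a)"
  unfolding mean_definable_iff_list
proof (intro allI impI exI)
  fix \<epsilon> :: real assume "\<epsilon> > 0"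
  then show "approximating_list A B \<phi> \<epsilon> (section_at B \<phi> a) [a]"
    using approximating_list_section[OF assms, of B \<phi>] by (force simp: approximating_list_def)
qed

lemma mean_pairing_in_interval:
  assumes p: "mean_definable A B \<phi> p" and q: "mean_definable B A (op_fun \<phi>) q"
    and "\<And>a. a \<in> A \<Longrightarrow> q a \<in> {l..u}"
  shows "mean_pairing A B \<phi> p q \<in> {l..u}"
proof -
  have "mean_pairing A B \<phi> p q \<le> u + e" "l \<le> mean_pairing A B \<phi> p q + e" if "e > 0" for e
  proof -
    obtain xs where xs: "approximating_list A B \<phi> e p xs"
      using p \<open>e > 0\<close> unfolding mean_definable_iff_list by auto
    then have "list_mean xs q \<in> {l..u}"
      using assms(3) by (intro list_mean_in_interval) (auto simp: approximating_list_def)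
    then have "l \<le> list_mean xs q" "list_mean xs q \<le> u" by auto
    with mean_pairing_approximation(1)[OF p q xs]
    show "mean_pairing A B \<phi> p q \<le> u + e" "l \<le> mean_pairing A B \<phi> p q + e" by linarith+
  qed
  then show ?thesis by (auto intro: field_le_epsilon)
qed

lemma mean_pairing_separately_continuous:
  assumes P: "\<And>p. p \<in> P \<Longrightarrow> mean_definable A B \<phi> p"
    and Q: "\<And>q. q \<in> Q \<Longrightarrow> mean_definable B A (op_fun \<phi>) q"
  shows "separately_continuous_on (powertop_real B) (powertop_real A) P Q (mean_pairing A B \<phi>)"
  unfolding separately_continuous_on_def
proof (intro conjI ballI)
  fix p assume p: "p \<in> P"
  show "continuous_map (subtopology (powertop_real A) Q) euclideanreal (mean_pairing A B \<phi> p)"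
    by (rule continuous_if_mean_approximated[OF P[OF p]])
      (rule mean_pairing_approximation(1)[OF P[OF p] Q])
next
  fix q assume q: "q \<in> Q"
  show "continuous_map (subtopology (powertop_real B) P) euclideanreal (\<lambda>p. mean_pairing A B \<phi> p q)"
    by (rule continuous_if_mean_approximated[OF Q[OF q]])
      (rule mean_pairing_approximation(2)[OF P Q[OF q]])
qed

lemma mean_pairing_extends_sections:
  assumes "\<And>a. a \<in> A \<Longrightarrow> mean_definable A B \<phi> (section_at B \<phi> a)"
    and "\<And>b. b \<in> B \<Longrightarrow> mean_definable B A (op_fun \<phi>) (section_at A (op_fun \<phi>) b)"
  shows "extends_sections A B \<phi> (mean_pairing A B \<phi>)"
  unfolding extends_sections_def
proof (intro ballI)
  fix a b assume ab: "a \<in> A" "b \<in> B"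
  have "\<bar>mean_pairing A B \<phi> (section_at B \<phi> a) (section_at A (op_fun \<phi>) b)
      - list_mean [a] (section_at A (op_fun \<phi>) b)\<bar> \<le> 0"
    by (rule mean_pairing_approximation(1)[OF assms(1)[OF ab(1)] assms(2)[OF ab(2)]
          approximating_list_section[OF ab(1)]])
  then show "mean_pairing A B \<phi> (section_at B \<phi> a) (section_at A (op_fun \<phi>) b) = \<phi> a b"
    using ab by (simp add: list_mean_def section_at_def op_fun_apply)
qed

lemma mean_definable_imp_continuous_extension:
  assumes \<phi>: "\<phi> \<in> A \<rightarrow> B \<rightarrow> {l..u}"
    and P: "\<And>p. p \<in> cl_sections A B \<phi> \<Longrightarrow> mean_definable A B \<phi> p"
    and Q: "\<And>q. q \<in> cl_sections B A (op_fun \<phi>) \<Longrightarrow> mean_definable B A (op_fun \<phi>) q"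
  shows "continuous_extension {l..u} A B \<phi> (mean_pairing A B \<phi>)"
  unfolding continuous_extension_def
proof (intro conjI Pi_I)
  fix p q assume p: "p \<in> cl_sections A B \<phi>" and q: "q \<in> cl_sections B A (op_fun \<phi>)"
  have "q \<in> cl_co_sections B A (op_fun \<phi>)" using cl_sections_subset_cl_co_sections q by (rule subsetD)
  then show "mean_pairing A B \<phi> p q \<in> {l..u}"
    by (intro mean_pairing_in_interval P[OF p] Q[OF q] cl_co_sections_bounded[OF op_fun_in_PiI[OF \<phi>]])
next
  show "extends_sections A B \<phi> (mean_pairing A B \<phi>)"
    by (intro mean_pairing_extends_sections mean_definable_section)
  show "separately_continuous_on (powertop_real B) (powertop_real A) (cl_sections A B \<phi>)
      (cl_sections B A (op_fun \<phi>)) (mean_pairing A B \<phi>)"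
    by (rule mean_pairing_separately_continuous[OF P Q])
qed

lemma mean_definable_imp_continuous_affine_extension:
  assumes \<phi>: "\<phi> \<in> A \<rightarrow> B \<rightarrow> {l..u}"
    and P: "\<And>p. p \<in> cl_co_sections A B \<phi> \<Longrightarrow> mean_definable A B \<phi> p"
    and Q: "\<And>q. q \<in> cl_co_sections B A (op_fun \<phi>) \<Longrightarrow> mean_definable B A (op_fun \<phi>) q"
  shows "continuous_affine_extension {l..u} A B \<phi> (mean_pairing A B \<phi>)"
  unfolding continuous_affine_extension_def
proof (intro conjI Pi_I)
  fix p q assume p: "p \<in> cl_co_sections A B \<phi>" and q: "q \<in> cl_co_sections B A (op_fun \<phi>)"
  show "mean_pairing A B \<phi> p q \<in> {l..u}"
    by (intro mean_pairing_in_interval P[OF p] Q[OF q] cl_co_sections_bounded[OF op_fun_in_PiI[OF \<phi>] q])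
next
  show "extends_sections A B \<phi> (mean_pairing A B \<phi>)"
    by (intro mean_pairing_extends_sections mean_definable_section)
  show "separately_continuous_on (powertop_real B) (powertop_real A) (cl_co_sections A B \<phi>)
      (cl_co_sections B A (op_fun \<phi>)) (mean_pairing A B \<phi>)"
    by (rule mean_pairing_separately_continuous[OF P Q])
  have bound: "\<bar>\<phi> a b\<bar> \<le> max \<bar>l\<bar> \<bar>u\<bar>" if "a \<in> A" "b \<in> B" for a b
    using Pi_mem[OF Pi_mem[OF \<phi> that(1)] that(2)] by auto
  show "separately_affine_on (cl_co_sections A B \<phi>) (cl_co_sections B A (op_fun \<phi>)) (mean_pairing A B \<phi>)"
    unfolding separately_affine_on_def
  proof (intro conjI ballI)
    fix p assume p: "p \<in> cl_co_sections A B \<phi>"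
    show "affine_map_on (cl_co_sections B A (op_fun \<phi>)) (mean_pairing A B \<phi> p)"
      using P[OF p] mean_pairing_approximation(1)[OF P[OF p]] bound Q
      by (rule affine_if_mean_approximated)
  next
    fix q assume q: "q \<in> cl_co_sections B A (op_fun \<phi>)"
    show "affine_map_on (cl_co_sections A B \<phi>) (\<lambda>p. mean_pairing A B \<phi> p q)"
    proof (rule affine_if_mean_approximated[OF Q[OF q]])
      show "\<bar>op_fun \<phi> b a\<bar> \<le> max \<bar>l\<bar> \<bar>u\<bar>" if "b \<in> B" "a \<in> A" for b a
        using bound that by (simp add: op_fun_apply)
      show "mean_definable A B (op_fun (op_fun \<phi>)) p" if "p \<in> cl_co_sections A B \<phi>" for p
        using P[OF that] by simp
      show "\<bar>mean_pairing A B \<phi> p q - list_mean ys p\<bar> \<le> \<epsilon>"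
        if "mean_definable A B (op_fun (op_fun \<phi>)) p" "approximating_list B A (op_fun \<phi>) \<epsilon> q ys" for p \<epsilon> ys
        by (rule mean_pairing_approximation(2)[OF that(1)[unfolded op_fun_op_fun] Q[OF q] that(2)])
    qed
  qed
qed

section \<open>The equivalence\<close>

text \<open>Uniform approximation of \<open>p\<close> by the convex hull, followed by approximation of the members of the
  hull by averages.\<close>
proposition double_limit_property_imp_mean_definable:
  assumes dlp: "double_limit_property A B \<phi>" and \<phi>: "\<phi> \<in> A \<rightarrow> B \<rightarrow> {l..u}"
    and p: "p \<in> cl_co_sections A B \<phi>"
  shows "mean_definable A B \<phi> p"
  unfolding mean_definable_iff_list
proof (intro allI impI)
  fix \<epsilon> :: real assume "\<epsilon> > 0"
  define M where "M = max \<bar>l\<bar> \<bar>u\<bar>"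
  have M: "\<bar>z\<bar> \<le> M" if "z \<in> {l..u}" for z using that by (auto simp: M_def)
  have "\<exists>f\<in>convex hull sections A B \<phi>. \<forall>b\<in>B. \<bar>f b - p b\<bar> \<le> \<epsilon> / 2"
  proof (rule pointwise_closure_convex_hull_uniformly_approximable)
    show "double_limit_property (sections A B \<phi>) B (\<lambda>f. f)"
      by (rule double_limit_property_sections[OF dlp])
    show "\<bar>f b\<bar> \<le> M" if "f \<in> sections A B \<phi>" "b \<in> B" for f b
      by (rule M[OF sections_bounded[OF \<phi> that]])
    show "\<exists>f\<in>convex hull sections A B \<phi>. \<forall>b\<in>D. \<bar>f b - p b\<bar> < \<eta>"
      if "finite D" "D \<subseteq> B" "\<eta> > 0" for D \<eta>
      using p that unfolding cl_co_sections_def by (rule pointwise_closure_approximation)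
    show "\<epsilon> / 2 > 0" using \<open>\<epsilon> > 0\<close> by simp
  qed
  then obtain f where f: "f \<in> convex hull sections A B \<phi>" "\<And>b. b \<in> B \<Longrightarrow> \<bar>f b - p b\<bar> \<le> \<epsilon> / 2"
    by blast
  have "\<bar>\<phi> a b\<bar> \<le> M" if "a \<in> A" "b \<in> B" for a b
    by (rule M[OF Pi_mem[OF Pi_mem[OF \<phi> that(1)] that(2)]])
  then have "convex {p. mean_definable A B \<phi> p}" by (rule convex_mean_definable)
  then have "convex hull sections A B \<phi> \<subseteq> {p. mean_definable A B \<phi> p}"
    by (intro hull_minimal) (auto simp: sections_def mean_definable_section)
  with f(1) have "mean_definable A B \<phi> f" by blast
  then obtain xs where "approximating_list A B \<phi> (\<epsilon> / 2) f xs"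
    using \<open>\<epsilon> > 0\<close> unfolding mean_definable_iff_list by (meson half_gt_zero)
  then have "xs \<noteq> []" "set xs \<subseteq> A" "\<And>b. b \<in> B \<Longrightarrow> \<bar>f b - list_mean xs (\<lambda>a. \<phi> a b)\<bar> \<le> \<epsilon> / 2"
    by (auto simp: approximating_list_def)
  then have "approximating_list A B \<phi> \<epsilon> p xs"
    unfolding approximating_list_def using f(2) by (smt (verit) field_sum_of_halves)
  then show "\<exists>xs. approximating_list A B \<phi> \<epsilon> p xs" by blast
qed

theorem theorem1p11:
  fixes l u :: real
    and A :: "'a set" and B :: "'b set"
    and \<phi> :: "'a \<Rightarrow> 'b \<Rightarrow> real"
  assumes "A \<noteq> {}" and "B \<noteq> {}"
    and "\<phi> \<in> A \<rightarrow> B \<rightarrow> {l..u}"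
  shows "(double_limit_property A B \<phi> \<longleftrightarrow>
           (\<exists>F. continuous_extension {l..u} A B \<phi> F)) \<and>
         (double_limit_property A B \<phi> \<longleftrightarrow>
           (\<exists>F. continuous_affine_extension {l..u} A B \<phi> F)) \<and>
         (double_limit_property A B \<phi> \<longleftrightarrow>
           (\<forall>p\<in>cl_sections A B \<phi>. mean_definable A B \<phi> p) \<and>
           (\<forall>q\<in>cl_sections B A (op_fun \<phi>). mean_definable B A (op_fun \<phi>) q)) \<and>
         (double_limit_property A B \<phi> \<longleftrightarrow>
           (\<forall>p\<in>cl_co_sections A B \<phi>. mean_definable A B \<phi> p) \<and>
           (\<forall>q\<in>cl_co_sections B A (op_fun \<phi>). mean_definable B A (op_fun \<phi>) q)) \<and>
         (\<forall>F G. continuous_extension {l..u} A B \<phi> F \<longrightarrow>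
           continuous_extension {l..u} A B \<phi> G \<longrightarrow>
           (\<forall>p\<in>cl_sections A B \<phi>. \<forall>q\<in>cl_sections B A (op_fun \<phi>). F p q = G p q)) \<and>
         (\<forall>F G. continuous_affine_extension {l..u} A B \<phi> F \<longrightarrow>
           continuous_affine_extension {l..u} A B \<phi> G \<longrightarrow>
           (\<forall>p\<in>cl_co_sections A B \<phi>. \<forall>q\<in>cl_co_sections B A (op_fun \<phi>). F p q = G p q))"
    (is "(?one \<longleftrightarrow> ?two) \<and> (?one \<longleftrightarrow> ?three) \<and> (?one \<longleftrightarrow> ?four) \<and> (?one \<longleftrightarrow> ?five) \<and>
      ?unique \<and> ?unique_affine")
proof -
  note \<phi> = assms(3)
  have "?five" if ?one
  proof -
    have op: "double_limit_property B A (op_fun \<phi>)" using that by (simp add: double_limit_property_op)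
    show ?thesis
      using double_limit_property_imp_mean_definable[OF that \<phi>]
        double_limit_property_imp_mean_definable[OF op op_fun_in_PiI[OF \<phi>]] by blast
  qed
  moreover have "?four" if "?five"
    using that cl_sections_subset_cl_co_sections[of A B \<phi>]
      cl_sections_subset_cl_co_sections[of B A "op_fun \<phi>"] by blast
  moreover have "?two" if "?four"
  proof -
    have "continuous_extension {l..u} A B \<phi> (mean_pairing A B \<phi>)"
      by (rule mean_definable_imp_continuous_extension[OF \<phi>]) (use that in simp_all)
    then show ?thesis by blast
  qed
  moreover have "?three" if "?five"
  proof -
    have "continuous_affine_extension {l..u} A B \<phi> (mean_pairing A B \<phi>)"
      by (rule mean_definable_imp_continuous_affine_extension[OF \<phi>]) (use that in simp_all)
    then show ?thesis by blast
  qed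
  moreover have "?two" if "?three"
    using that continuous_affine_extension_imp_continuous_extension by blast
  moreover have "?one" if "?two"
    using that continuous_extension_imp_double_limit_property[OF \<phi>] by blast
  moreover have "?unique" "?unique_affine"
    by (intro allI impI ballI; erule (3) continuous_extension_unique continuous_affine_extension_unique)+
  ultimately show ?thesis by argo
qed

end
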